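(* Let $T$ be a bounded linear operator such that $\sigma(T)\subsetneq B(z,|z|)$ for some $z\in\mathbb{C}$. Then there exists $\rho\in\mathbb{C}$ such that $\frac{\sigma(T)}{\rho}=\sigma\big(\frac{T}{\rho}\big)\subset B(1,1)$. Then $$\Big(\frac{T}{\rho}\Big)^\alpha=\sum_{n=0}^\infty\bigg[\sum_{k=0}^n P_k(n)\Big(\frac{T}{\rho}\Big)^k\bigg]P_n(\alpha).$$ As such, $$T^\alpha=\sum_{n=0}^\infty\bigg[\sum_{k=0}^n P_k(n)\,\rho^{\alpha-k}\,T^k\bigg]P_n(\alpha).$$
   Context: $\sigma(T)$ is the spectrum of $T$, and $B(z,r)$ is the open disc in $\mathbb{C}$ with center $z$ and radius $r$. For integers $n\ge 0$, the $n$-th Pochhammer-Newton polynomial is $P_n(\alpha)=(-1)^n\binom{\alpha}{n}=\frac{(-1)^n}{n!}\prod_{m=0}^{n-1}(\alpha-m)$. The exponent $\alpha$ is a complex number, on which no restriction is placed. Fractional powers of operators are those of the functional calculus for $\lambda\mapsto\lambda^\alpha$, and the principal branch is taken for all fractional powers and logarithms.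
   Formalization: With the principal branch, the formula for T^α fails in general (T=diag(e^{3πi/4},e^{-3πi/4}), α=1/2); it is proved if α is an integer or -π<Arg ρ+Arg(w/ρ)<π on σ(T), and otherwise for the branch ρ^α(w/ρ)^α of w^α. *)

theory Defs
  imports "HOL-Complex_Analysis.Complex_Analysis"
begin

section \<open>Complex Banach spaces and their bounded operators\<close>

text \<open>
  The library's Banach spaces are real. A complex Banach space is one with a compatible
  multiplication by complex scalars; the norm is the given one and is complex homogeneous.
\<close>

class complex_banach = banach +
  fixes scaleC :: "complex \<Rightarrow> 'a \<Rightarrow> 'a"  (infixr "*\<^sub>C" 75)
  assumes scaleC_add_right: "c *\<^sub>C (x + y) = c *\<^sub>C x + c *\<^sub>C y"
    and scaleC_add_left: "(c + d) *\<^sub>C x = c *\<^sub>C x + d *\<^sub>C x"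
    and scaleC_scaleC: "c *\<^sub>C d *\<^sub>C x = (c * d) *\<^sub>C x"
    and scaleC_of_real: "complex_of_real r *\<^sub>C x = r *\<^sub>R x"
    and norm_scaleC: "norm (c *\<^sub>C x) = cmod c * norm x"

lemma bounded_linear_scaleC: "bounded_linear (\<lambda>x::'a::complex_banach. c *\<^sub>C x)"
proof (rule bounded_linear_intro[where K = "cmod c"])
  fix r :: real and x :: 'a
  show "c *\<^sub>C r *\<^sub>R x = r *\<^sub>R c *\<^sub>C x"
    by (simp add: scaleC_of_real[symmetric] scaleC_scaleC mult.commute)
qed (simp_all add: scaleC_add_right norm_scaleC mult.commute)

instantiation blinfun :: (real_normed_vector, complex_banach) complex_banach
begin

lift_definition scaleC_blinfun :: "complex \<Rightarrow> ('a \<Rightarrow>\<^sub>L 'b) \<Rightarrow> ('a \<Rightarrow>\<^sub>L 'b)"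
  is "\<lambda>c T x. c *\<^sub>C T x"
  by (rule bounded_linear_compose[OF bounded_linear_scaleC])

instance
proof
  fix c d :: complex and r :: real and S T :: "'a \<Rightarrow>\<^sub>L 'b"
  show "c *\<^sub>C (S + T) = c *\<^sub>C S + c *\<^sub>C T"
    by transfer (simp add: scaleC_add_right)
  show "(c + d) *\<^sub>C T = c *\<^sub>C T + d *\<^sub>C T"
    by transfer (simp add: scaleC_add_left)
  show "c *\<^sub>C d *\<^sub>C T = (c * d) *\<^sub>C T"
    by transfer (simp add: scaleC_scaleC)
  show "complex_of_real r *\<^sub>C T = r *\<^sub>R T"
    by transfer (simp add: scaleC_of_real)
  have le: "norm (b *\<^sub>C A) \<le> cmod b * norm A" for b and A :: "'a \<Rightarrow>\<^sub>L 'b"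
  proof (rule norm_blinfun_bound)
    fix x
    have "norm (blinfun_apply A x) \<le> norm A * norm x"
      by (rule norm_blinfun)
    then show "norm (blinfun_apply (b *\<^sub>C A) x) \<le> cmod b * norm A * norm x"
      by (simp add: scaleC_blinfun.rep_eq norm_scaleC mult.assoc mult_left_mono)
  qed simp
  show "norm (c *\<^sub>C T) = cmod c * norm T"
  proof (cases "c = 0")
    case True
    then show ?thesis using le[of c T] by simp
  next
    case False
    then have "inverse c *\<^sub>C c *\<^sub>C T = T"
      by transfer (simp add: scaleC_scaleC scaleC_of_real[of 1, simplified])
    then have "norm T \<le> inverse (cmod c) * norm (c *\<^sub>C T)"
      using le[of "inverse c" "c *\<^sub>C T"] by (simp add: norm_inverse)
    then have "cmod c * norm T \<le> norm (c *\<^sub>C T)"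
      using False by (simp add: field_simps)
    with le[of c T] show ?thesis by simp
  qed
qed

end

text \<open>
  Elements of the type \<^typ>\<open>'a \<Rightarrow>\<^sub>L 'a\<close> are bounded and real linear; the bounded operators of
  a complex Banach space are those that also commute with complex scalars.
\<close>

definition complex_linear :: "('a::complex_banach \<Rightarrow>\<^sub>L 'a) \<Rightarrow> bool" where
  "complex_linear T \<longleftrightarrow> (\<forall>c x. blinfun_apply T (c *\<^sub>C x) = c *\<^sub>C blinfun_apply T x)"

definition op_power :: "('a::complex_banach \<Rightarrow>\<^sub>L 'a) \<Rightarrow> nat \<Rightarrow> ('a \<Rightarrow>\<^sub>L 'a)" where
  "op_power T k = ((o\<^sub>L) T ^^ k) id_blinfun"

section \<open>Spectrum and holomorphic functional calculus\<close>

definition is_op_inverse :: "('a::complex_banach \<Rightarrow>\<^sub>L 'a) \<Rightarrow> ('a \<Rightarrow>\<^sub>L 'a) \<Rightarrow> bool" where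
  "is_op_inverse A S \<longleftrightarrow> A o\<^sub>L S = id_blinfun \<and> S o\<^sub>L A = id_blinfun"

definition spectrum :: "('a::complex_banach \<Rightarrow>\<^sub>L 'a) \<Rightarrow> complex set" where
  "spectrum T = {w. \<nexists>S. is_op_inverse (w *\<^sub>C id_blinfun - T) S}"

definition resolvent :: "('a::complex_banach \<Rightarrow>\<^sub>L 'a) \<Rightarrow> complex \<Rightarrow> ('a \<Rightarrow>\<^sub>L 'a)" where
  "resolvent T w = (THE S. is_op_inverse (w *\<^sub>C id_blinfun - T) S)"

text \<open>
  The library's contour integral is restricted to complex-valued integrands; this is the same
  formula for integrands with values in a complex Banach space.
\<close>

definition vec_contour_integral ::
    "(real \<Rightarrow> complex) \<Rightarrow> (complex \<Rightarrow> 'b::complex_banach) \<Rightarrow> 'b" where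
  "vec_contour_integral \<gamma> F =
     integral {0..1} (\<lambda>t. vector_derivative \<gamma> (at t within {0..1}) *\<^sub>C F (\<gamma> t))"

text \<open>
  A cycle, given as a list of closed paths, that lies in \<open>U\<close> outside \<open>K\<close> and winds
  once around every point of \<open>K\<close> and not at all around the points outside \<open>U\<close>.
\<close>

definition surrounds :: "(real \<Rightarrow> complex) list \<Rightarrow> complex set \<Rightarrow> complex set \<Rightarrow> bool" where
  "surrounds \<Gamma> K U \<longleftrightarrow>
     (\<forall>\<gamma>\<in>set \<Gamma>. valid_path \<gamma> \<and> pathfinish \<gamma> = pathstart \<gamma> \<and> path_image \<gamma> \<subseteq> U - K) \<and>
     (\<forall>w\<in>K. (\<Sum>\<gamma>\<leftarrow>\<Gamma>. winding_number \<gamma> w) = 1) \<and>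
     (\<forall>w. w \<notin> U \<longrightarrow> (\<Sum>\<gamma>\<leftarrow>\<Gamma>. winding_number \<gamma> w) = 0)"

text \<open>
  \<open>has_fun_calc f T S\<close> says that \<open>f(T)\<close> is defined by the Riesz--Dunford integral and has the
  value \<open>S\<close>. By Cauchy's theorem \<open>S\<close> does not depend on the neighbourhood or on the cycle.
\<close>

definition has_fun_calc ::
    "(complex \<Rightarrow> complex) \<Rightarrow> ('a::complex_banach \<Rightarrow>\<^sub>L 'a) \<Rightarrow> ('a \<Rightarrow>\<^sub>L 'a) \<Rightarrow> bool" where
  "has_fun_calc f T S \<longleftrightarrow>
     (\<exists>U \<Gamma>. open U \<and> spectrum T \<subseteq> U \<and> f holomorphic_on U \<and> surrounds \<Gamma> (spectrum T) U \<and>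
        S = (1 / (2 * of_real pi * \<i>)) *\<^sub>C
              (\<Sum>\<gamma>\<leftarrow>\<Gamma>. vec_contour_integral \<gamma> (\<lambda>w. f w *\<^sub>C resolvent T w)))"

section \<open>Branches of the power and Pochhammer--Newton polynomials\<close>

text \<open>
  The branch of \<open>w \<mapsto> w\<^sup>\<alpha>\<close> on the half-plane \<open>Re (w / \<rho>) > 0\<close> whose value at \<open>\<rho>\<close> is
  the principal \<open>\<rho>\<^sup>\<alpha>\<close>. It is the exponential of \<open>\<alpha> * (Ln \<rho> + Ln (w / \<rho>))\<close>, and it can
  differ from the principal branch when that half-plane meets the negative real axis.
\<close>

definition powr_branch :: "complex \<Rightarrow> complex \<Rightarrow> complex \<Rightarrow> complex" where
  "powr_branch \<rho> \<alpha> w = \<rho> powr \<alpha> * (w / \<rho>) powr \<alpha>"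

definition pochhammer_newton :: "nat \<Rightarrow> complex \<Rightarrow> complex" where
  "pochhammer_newton n \<alpha> = (-1) ^ n * (\<alpha> gchoose n)"

end

theory Submission
  imports Defs
begin

text \<open>
  On a disc \<open>ball c R\<close> containing the spectrum, expand \<open>f\<close> in powers of \<open>w - c\<close>; the Riesz--Dunford
  integral over a circle about \<open>c\<close> then turns \<open>(w - c) ^ n\<close> into \<open>(T - c) ^ n\<close>, because
  \<open>(w - c) * resolvent T w = 1 + (T - c) * resolvent T w\<close> and the mean of \<open>(w - c) * resolvent T w\<close> does not
  depend on the radius and tends to 1. The inner sum of the series is \<open>(1 - T / \<rho>) ^ n\<close> by the
  binomial theorem, so with \<open>c = \<rho>\<close> the series is the one of \<open>w powr \<alpha>\<close> about \<open>\<rho>\<close>. When the disc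
  about \<open>\<rho>\<close> meets the branch cut but the spectrum lies on one side of it, the circle is moved into
  that side without crossing the spectrum.
\<close>

section \<open>Operators on a complex Banach space\<close>

text \<open>The obstacle is the branch. The series about \<open>\<rho>\<close> always sums to the
  branch continued from \<open>\<rho>\<close> inside \<open>ball \<rho> (cmod \<rho>)\<close>. This
  disc has 0 on its boundary, and as soon as \<open>\<bar>Arg \<rho>\<bar> > pi / 2\<close> it
  contains a piece of the negative axis, where a principal power with a noninteger exponent jumps. A
  circle about \<open>\<rho>\<close> may then be no admissible cycle for the principal power. The
  condition on \<open>Arg \<rho> + Arg (w / \<rho>)\<close> says that the argument continued from
  \<open>\<rho>\<close> to \<open>w\<close> still lies strictly between -pi and pi; it forces the
  spectrum into the open upper or lower half-plane, where the principal power is holomorphic.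
  Cauchy's theorem is needed only along families of circles, where it reduces to differentiation
  under the integral sign. The origin stays outside every circle that is moved to the half-plane,
  since its radius is smaller than the modulus of its centre.\<close>

lemma bounded_bilinear_scaleC:
  "bounded_bilinear (\<lambda>c (x::'a::complex_banach). c *\<^sub>C x)"
proof
  fix r :: real and c :: complex and x :: 'a
  show "(r *\<^sub>R c) *\<^sub>C x = r *\<^sub>R c *\<^sub>C x"
    by (simp add: scaleC_of_real[symmetric] scaleC_scaleC scaleR_conv_of_real)
  show "c *\<^sub>C r *\<^sub>R x = r *\<^sub>R c *\<^sub>C x"
    by (rule linear_scale[OF bounded_linear.linear[OF bounded_linear_scaleC]])
  show "\<exists>K. \<forall>a (b::'a). norm (a *\<^sub>C b) \<le> norm a * norm b * K"
    by (auto simp: norm_scaleC intro: exI[of _ 1])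
qed (simp_all add: scaleC_add_left scaleC_add_right)

interpretation scaleC: bounded_bilinear "\<lambda>c (x::'a::complex_banach). c *\<^sub>C x"
  by (rule bounded_bilinear_scaleC)

interpretation blinfun_compose: bounded_bilinear
    "(o\<^sub>L) :: ('b::real_normed_vector \<Rightarrow>\<^sub>L 'c::real_normed_vector) \<Rightarrow> ('a::real_normed_vector \<Rightarrow>\<^sub>L 'b) \<Rightarrow> 'a \<Rightarrow>\<^sub>L 'c"
  by (rule bounded_bilinear_blinfun_compose)

declare scaleC.zero_left [simp] scaleC.zero_right [simp]

lemma scaleC_one [simp]: "1 *\<^sub>C (x::'a::complex_banach) = x"
  using scaleC_of_real[of 1 x] by simp

lemma blinfun_compose_assoc: "(A o\<^sub>L B) o\<^sub>L C = A o\<^sub>L (B o\<^sub>L C)"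
  by (rule blinfun_eqI) simp

lemma blinfun_compose_id [simp]: "A o\<^sub>L id_blinfun = A" "id_blinfun o\<^sub>L A = A"
  by (auto intro: blinfun_eqI)

lemma scaleC_compose_left [simp]: "(c *\<^sub>C A) o\<^sub>L B = c *\<^sub>C (A o\<^sub>L B)"
  by (rule blinfun_eqI) (simp add: scaleC_blinfun.rep_eq)

lemma scaleC_compose_right:
  "complex_linear A \<Longrightarrow> A o\<^sub>L (c *\<^sub>C B) = c *\<^sub>C (A o\<^sub>L B)"
  by (rule blinfun_eqI) (simp add: scaleC_blinfun.rep_eq complex_linear_def)

lemma complex_linear_id: "complex_linear id_blinfun"
  by (simp add: complex_linear_def)

lemma complex_linear_scaleC: "complex_linear A \<Longrightarrow> complex_linear (c *\<^sub>C A)"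
  by (simp add: complex_linear_def scaleC_blinfun.rep_eq scaleC_scaleC mult.commute)

lemma complex_linear_diff: "complex_linear A \<Longrightarrow> complex_linear B \<Longrightarrow> complex_linear (A - B)"
  by (simp add: complex_linear_def blinfun.diff_left scaleC.diff_right)

lemmas complex_linear_intros = complex_linear_id complex_linear_scaleC complex_linear_diff

lemma op_power_0 [simp]: "op_power A 0 = id_blinfun"
  and op_power_Suc [simp]: "op_power A (Suc n) = A o\<^sub>L op_power A n"
  by (simp_all add: op_power_def)

lemma op_power_scaleC:
  "complex_linear A \<Longrightarrow> op_power (c *\<^sub>C A) n = c ^ n *\<^sub>C op_power A n"
  by (induction n) (simp_all add: scaleC_compose_right scaleC_scaleC)

lemma norm_op_power_le: "norm (op_power A n) \<le> norm A ^ n"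
proof (induction n)
  case (Suc n)
  then show ?case
    by (simp add: order_trans[OF norm_blinfun_compose] mult_left_mono)
qed (simp add: norm_blinfun_id_le)

lemma op_power_diff_id:
  assumes "complex_linear A"
  shows "op_power (A - id_blinfun) n = (\<Sum>k\<le>n. ((-1) ^ (n + k) * of_nat (n choose k)) *\<^sub>C op_power A k)"
proof (induction n)
  case (Suc n)
  let ?g = "\<lambda>k. op_power A k"
  \<comment> \<open>Multiplication by \<open>A\<close> shifts the index. The case
    \<open>k = 0\<close> is set apart because \<open>0 - 1 = 0\<close> on naturals would give the
    coefficient \<open>n choose 0 = 1\<close>. With the shift, the last step is Pascal's
    rule.\<close>
  have A: "A o\<^sub>L (\<Sum>k\<le>n. ((-1) ^ (n + k) * of_nat (n choose k)) *\<^sub>C ?g k)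
      = (\<Sum>k\<le>Suc n. (if k = 0 then 0 else (-1) ^ (Suc n + k) * of_nat (n choose (k - 1))) *\<^sub>C ?g k)"
    by (subst sum.atMost_Suc_shift)
       (simp add: blinfun_compose.sum_right scaleC_compose_right assms)
  have B: "(\<Sum>k\<le>n. ((-1) ^ (n + k) * of_nat (n choose k)) *\<^sub>C ?g k)
      = (\<Sum>k\<le>Suc n. ((-1) ^ (n + k) * of_nat (n choose k)) *\<^sub>C ?g k)"
    by (simp add: binomial_eq_0)
  have "op_power (A - id_blinfun) (Suc n) = (\<Sum>k\<le>Suc n.
      (if k = 0 then 0 else (-1) ^ (Suc n + k) * of_nat (n choose (k - 1))) *\<^sub>C ?g k
      - ((-1) ^ (n + k) * of_nat (n choose k)) *\<^sub>C ?g k)"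
    unfolding op_power_Suc Suc.IH blinfun_compose.diff_left blinfun_compose_id A sum_subtractf
    by (simp only: B)
  also have "\<dots> = (\<Sum>k\<le>Suc n. ((-1) ^ (Suc n + k) * of_nat (Suc n choose k)) *\<^sub>C ?g k)"
  proof (rule sum.cong[OF refl])
    fix k
    show "(if k = 0 then 0 else (-1) ^ (Suc n + k) * of_nat (n choose (k - 1))) *\<^sub>C ?g k
      - ((-1) ^ (n + k) * of_nat (n choose k)) *\<^sub>C ?g k
      = ((-1) ^ (Suc n + k) * of_nat (Suc n choose k)) *\<^sub>C ?g k"
      by (cases k) (simp_all add: scaleC.diff_left[symmetric] algebra_simps scaleC.minus_left[symmetric])
  qed
  finally show ?case .
qed simp

lemma sum_pochhammer_newton_op_power:
  assumes "complex_linear A"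
  shows "(\<Sum>k\<le>n. pochhammer_newton k (of_nat n) *\<^sub>C op_power A k) = (-1) ^ n *\<^sub>C op_power (A - id_blinfun) n"
  unfolding op_power_diff_id[OF assms] scaleC.sum_right scaleC_scaleC
  by (rule sum.cong)
     (simp_all add: pochhammer_newton_def binomial_gbinomial power_add mult.assoc[symmetric]
       power_mult_distrib[symmetric])

section \<open>The resolvent\<close>

lemma is_op_inverse_unique: "is_op_inverse A S \<Longrightarrow> is_op_inverse A S' \<Longrightarrow> S = S'"
  unfolding is_op_inverse_def by (metis blinfun_compose_assoc blinfun_compose_id)

text \<open>\<open>spectrum\<close> admits inverses that are merely real linear. For complex linear
  \<open>A\<close> this changes nothing: applying \<open>S\<close> to
  \<open>A (c *\<^sub>C S x) = c *\<^sub>C x\<close> shows that the inverse commutes with complex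
  scalars.\<close>

lemma complex_linear_inverse:
  assumes "is_op_inverse A S" "complex_linear A"
  shows "complex_linear S"
  unfolding complex_linear_def
proof (intro allI)
  fix c x
  have AS: "blinfun_apply A (blinfun_apply S y) = y" and SA: "blinfun_apply S (blinfun_apply A y) = y" for y
    using assms(1) unfolding is_op_inverse_def
    by (metis blinfun_apply_blinfun_compose id_blinfun.rep_eq)+
  have "blinfun_apply A (c *\<^sub>C blinfun_apply S x) = c *\<^sub>C x"
    using assms(2) by (simp add: complex_linear_def AS)
  then show "blinfun_apply S (c *\<^sub>C x) = c *\<^sub>C blinfun_apply S x"
    by (metis SA)
qed

lemma resolvent_inverse:
  assumes "w \<notin> spectrum T"
  shows "is_op_inverse (w *\<^sub>C id_blinfun - T) (resolvent T w)"
  using assms theI[of "is_op_inverse (w *\<^sub>C id_blinfun - T)"] is_op_inverse_unique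
  unfolding spectrum_def resolvent_def by blast

lemma resolvent_right: "w \<notin> spectrum T \<Longrightarrow> (w *\<^sub>C id_blinfun - T) o\<^sub>L resolvent T w = id_blinfun"
  and resolvent_left: "w \<notin> spectrum T \<Longrightarrow> resolvent T w o\<^sub>L (w *\<^sub>C id_blinfun - T) = id_blinfun"
  using resolvent_inverse[of w T] by (auto simp: is_op_inverse_def)

lemma complex_linear_resolvent:
  "complex_linear T \<Longrightarrow> w \<notin> spectrum T \<Longrightarrow> complex_linear (resolvent T w)"
  by (rule complex_linear_inverse[OF resolvent_inverse]) (auto intro: complex_linear_intros)

lemma scaleC_resolvent:
  assumes "w \<notin> spectrum T"
  shows "(w - c) *\<^sub>C resolvent T w = id_blinfun + ((T - c *\<^sub>C id_blinfun) o\<^sub>L resolvent T w)"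
  using resolvent_right[OF assms]
  by (simp add: blinfun_compose.diff_left scaleC.diff_left algebra_simps)

text \<open>Insert \<open>w - T\<close> times its resolvent behind \<open>resolvent T v\<close> and
  split \<open>w - T\<close> as \<open>(v - T) - (v - w)\<close>. The increment appears as the
  scalar \<open>v - w\<close> times an operator, as continuity and differentiation need it.\<close>

lemma resolvent_identity:
  assumes "complex_linear T" "v \<notin> spectrum T" "w \<notin> spectrum T"
  shows "resolvent T v = resolvent T w + (v - w) *\<^sub>C (- (resolvent T v o\<^sub>L resolvent T w))"
proof -
  let ?V = "resolvent T v" and ?W = "resolvent T w"
  have "?V = ?V o\<^sub>L ((w *\<^sub>C id_blinfun - T) o\<^sub>L ?W)"
    using assms by (simp add: resolvent_right)
  also have "w *\<^sub>C id_blinfun - T = (v *\<^sub>C id_blinfun - T) - (v - w) *\<^sub>C id_blinfun"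
    by (simp add: scaleC.diff_left)
  also have "?V o\<^sub>L (\<dots> o\<^sub>L ?W) = ((?V o\<^sub>L (v *\<^sub>C id_blinfun - T)) o\<^sub>L ?W)
      - (v - w) *\<^sub>C (?V o\<^sub>L ?W)"
    by (simp only: blinfun_compose.diff_left blinfun_compose.diff_right scaleC_compose_left
        blinfun_compose_id blinfun_compose_assoc
        scaleC_compose_right[OF complex_linear_resolvent[OF assms(1,2)]])
  also have "\<dots> = ?W + (v - w) *\<^sub>C (- (?V o\<^sub>L ?W))"
    by (simp add: resolvent_left[OF assms(2)] scaleC.minus_right)
  finally show ?thesis .
qed

section \<open>Perturbation of the resolvent: openness, continuity, derivative\<close>

lemma neumann_inverse:
  fixes X :: "'a::complex_banach \<Rightarrow>\<^sub>L 'a"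
  assumes "norm X < 1"
  obtains S where "is_op_inverse (id_blinfun - X) S"
proof
  let ?S = "\<Sum>n. op_power X n"
  have s: "summable (\<lambda>n. op_power X n)"
    by (rule summable_comparison_test'[OF summable_geometric[of "norm X"]])
       (use assms norm_op_power_le in auto)
  have tail: "(\<Sum>n. op_power X (Suc n)) = ?S - id_blinfun"
    using suminf_split_head[OF s] by simp
  have comm: "op_power X n o\<^sub>L X = X o\<^sub>L op_power X n" for n
    by (induction n) (simp_all add: blinfun_compose_assoc)
  have "X o\<^sub>L ?S = ?S - id_blinfun"
    using bounded_linear.suminf[OF blinfun_compose.bounded_linear_right s, of X] tail by simp
  moreover have "?S o\<^sub>L X = ?S - id_blinfun"
    using bounded_linear.suminf[OF blinfun_compose.bounded_linear_left s, of X] tail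
    by (simp add: comm)
  ultimately show "is_op_inverse (id_blinfun - X) ?S"
    by (simp add: is_op_inverse_def blinfun_compose.diff_left blinfun_compose.diff_right)
qed

lemma resolvent_set_ball:
  assumes T: "complex_linear T" and w: "w \<notin> spectrum T" and v: "cmod (v - w) * norm (resolvent T w) < 1"
  shows "v \<notin> spectrum T"
proof -
  let ?W = "resolvent T w" and ?A = "w *\<^sub>C id_blinfun - T"
  let ?X = "(w - v) *\<^sub>C ?W"
  have "norm ?X < 1"
    using v by (simp add: norm_scaleC norm_minus_commute)
  then obtain S where S: "(id_blinfun - ?X) o\<^sub>L S = id_blinfun" "S o\<^sub>L (id_blinfun - ?X) = id_blinfun"
    using neumann_inverse unfolding is_op_inverse_def by blast
  have A: "complex_linear ?A"
    using T by (intro complex_linear_intros)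
  have eq: "v *\<^sub>C id_blinfun - T = ?A - (w - v) *\<^sub>C id_blinfun"
    by (simp add: scaleC.diff_left)
  have l: "?A o\<^sub>L (id_blinfun - ?X) = v *\<^sub>C id_blinfun - T"
    unfolding eq by (simp add: blinfun_compose.diff_right scaleC_compose_right[OF A] resolvent_right[OF w])
  have r: "(id_blinfun - ?X) o\<^sub>L ?A = v *\<^sub>C id_blinfun - T"
    unfolding eq by (simp add: blinfun_compose.diff_left resolvent_left[OF w])
  \<comment> \<open>The factorization \<open>l\<close> only yields a right inverse and
    \<open>r\<close> only a left inverse, with the factors in opposite order; two such inverses
    coincide.\<close>
  have right: "(v *\<^sub>C id_blinfun - T) o\<^sub>L (S o\<^sub>L ?W) = id_blinfun"
    unfolding l[symmetric]
    by (metis S(1) blinfun_compose_assoc blinfun_compose_id(2) resolvent_right[OF w])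
  have left: "(?W o\<^sub>L S) o\<^sub>L (v *\<^sub>C id_blinfun - T) = id_blinfun"
    unfolding r[symmetric]
    by (metis S(2) blinfun_compose_assoc blinfun_compose_id(2) resolvent_left[OF w])
  have "S o\<^sub>L ?W = ?W o\<^sub>L S"
    using left right by (metis blinfun_compose_assoc blinfun_compose_id)
  with left right have "is_op_inverse (v *\<^sub>C id_blinfun - T) (S o\<^sub>L ?W)"
    by (simp add: is_op_inverse_def)
  then show ?thesis
    by (auto simp: spectrum_def)
qed

lemma closed_spectrum:
  assumes "complex_linear T"
  shows "closed (spectrum T)"
  unfolding closed_def open_dist
proof safe
  fix w assume w: "w \<notin> spectrum T"
  let ?e = "1 / (norm (resolvent T w) + 1)"
  have "v \<notin> spectrum T" if "dist v w < ?e" for v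
  proof (rule resolvent_set_ball[OF assms w])
    have "cmod (v - w) * norm (resolvent T w) \<le> cmod (v - w) * (norm (resolvent T w) + 1)"
      by (intro mult_left_mono) auto
    also have "\<dots> < 1"
      using that by (simp add: dist_norm pos_less_divide_eq add_nonneg_pos)
    finally show "cmod (v - w) * norm (resolvent T w) < 1" .
  qed
  moreover have "?e > 0"
    by (simp add: add_nonneg_pos)
  ultimately show "\<exists>e>0. \<forall>v. dist v w < e \<longrightarrow> v \<in> - spectrum T"
    by (intro exI[of _ ?e]) auto
qed

text \<open>The resolvent identity bounds \<open>norm (resolvent T v)\<close> by
  \<open>norm (resolvent T w)\<close> plus half of itself, and the half is absorbed. This local
  bound precedes continuity.\<close>

lemma norm_resolvent_le:
  assumes T: "complex_linear T" and vw: "v \<notin> spectrum T" "w \<notin> spectrum T"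
    and small: "cmod (v - w) * norm (resolvent T w) \<le> 1 / 2"
  shows "norm (resolvent T v) \<le> 2 * norm (resolvent T w)"
proof -
  let ?V = "resolvent T v" and ?W = "resolvent T w"
  have "norm ?V \<le> norm ?W + norm ((v - w) *\<^sub>C (- (?V o\<^sub>L ?W)))"
    using resolvent_identity[OF T vw] norm_triangle_ineq by metis
  also have "norm ((v - w) *\<^sub>C (- (?V o\<^sub>L ?W))) \<le> cmod (v - w) * (norm ?V * norm ?W)"
    by (simp add: norm_scaleC mult_left_mono norm_blinfun_compose)
  also have "\<dots> = (cmod (v - w) * norm ?W) * norm ?V"
    by simp
  also have "\<dots> \<le> 1 / 2 * norm ?V"
    using small by (intro mult_right_mono) auto
  finally show ?thesis by simp
qed

lemma continuous_resolvent:
  assumes T: "complex_linear T" and w: "w \<notin> spectrum T"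
  shows "isCont (resolvent T) w"
proof -
  let ?W = "resolvent T w"
  have lim: "((\<lambda>v. cmod (v - w) * norm ?W) \<longlongrightarrow> 0) (at w)"
    by (auto intro!: tendsto_eq_intros)
  \<comment> \<open>The bound 1/2 serves twice: being below 1 it keeps \<open>v\<close> outside the
    spectrum, and it is what \<open>norm_resolvent_le\<close> asks for.\<close>
  then have ev: "\<forall>\<^sub>F v in at w. cmod (v - w) * norm ?W < 1 / 2"
    by (rule order_tendstoD) simp
  have "\<forall>\<^sub>F v in at w. norm (resolvent T v - ?W) \<le> cmod (v - w) * norm ?W * (2 * norm ?W)"
    using ev
  proof eventually_elim
    case (elim v)
    then have v: "v \<notin> spectrum T"
      by (intro resolvent_set_ball[OF T w]) auto
    have "resolvent T v - ?W = (v - w) *\<^sub>C (- (resolvent T v o\<^sub>L ?W))"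
      using resolvent_identity[OF T v w] by (simp add: algebra_simps)
    then have "norm (resolvent T v - ?W) = cmod (v - w) * norm (resolvent T v o\<^sub>L ?W)"
      by (simp add: norm_scaleC)
    also have "\<dots> \<le> cmod (v - w) * ((2 * norm ?W) * norm ?W)"
      using norm_resolvent_le[OF T v w] elim
      by (intro mult_left_mono order_trans[OF norm_blinfun_compose] mult_right_mono) auto
    finally show ?case by (simp add: mult_ac)
  qed
  moreover have "((\<lambda>v. cmod (v - w) * norm ?W * (2 * norm ?W)) \<longlongrightarrow> 0) (at w)"
    by (auto intro!: tendsto_eq_intros)
  ultimately have "((\<lambda>v. resolvent T v - ?W) \<longlongrightarrow> 0) (at w)"
    by (rule Lim_null_comparison)
  then show ?thesis
    by (simp add: isCont_def LIM_zero_iff)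
qed

lemma continuous_on_resolvent:
  "complex_linear T \<Longrightarrow> continuous_on (- spectrum T) (resolvent T)"
  by (auto intro: continuous_at_imp_continuous_on continuous_resolvent)

text \<open>By the resolvent identity the remainder divided by \<open>norm (v - w)\<close> is
  exactly the norm of \<open>resolvent T v o\<^sub>L ?W - ?W o\<^sub>L ?W\<close>, so continuity of
  the resolvent suffices.\<close>

lemma has_derivative_resolvent:
  assumes T: "complex_linear T" and w: "w \<notin> spectrum T"
  shows "(resolvent T has_derivative (\<lambda>h. h *\<^sub>C (- (resolvent T w o\<^sub>L resolvent T w)))) (at w)"
proof -
  let ?W = "resolvent T w" and ?D = "- (resolvent T w o\<^sub>L resolvent T w)"
  have "\<forall>\<^sub>F v in at w. v \<notin> spectrum T"
    using eventually_at_topological closed_spectrum[OF T] w by (auto simp: closed_def)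
  then have ev: "\<forall>\<^sub>F v in at w. norm (resolvent T v - ?W - (v - w) *\<^sub>C ?D) / norm (v - w)
      = norm ((resolvent T v o\<^sub>L ?W) - (?W o\<^sub>L ?W))"
    using eventually_neq_at_within[of w]
  proof eventually_elim
    case (elim v)
    have "resolvent T v - ?W - (v - w) *\<^sub>C ?D = - ((v - w) *\<^sub>C ((resolvent T v o\<^sub>L ?W) - (?W o\<^sub>L ?W)))"
      using resolvent_identity[OF T elim(1) w]
      by (simp add: scaleC.minus_right scaleC.diff_right algebra_simps)
    then have "norm (resolvent T v - ?W - (v - w) *\<^sub>C ?D)
        = norm (v - w) * norm ((resolvent T v o\<^sub>L ?W) - (?W o\<^sub>L ?W))"
      by (simp add: norm_scaleC)
    with elim show ?case by simp
  qed
  have "((\<lambda>v. norm ((resolvent T v o\<^sub>L ?W) - (?W o\<^sub>L ?W))) \<longlongrightarrow> norm ((?W o\<^sub>L ?W) - (?W o\<^sub>L ?W))) (at w)"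
    by (intro tendsto_norm tendsto_diff tendsto_const blinfun_compose.tendsto
        continuous_resolvent[OF T w, unfolded isCont_def])
  then have "((\<lambda>v. norm (resolvent T v - ?W - (v - w) *\<^sub>C ?D) / norm (v - w)) \<longlongrightarrow> 0) (at w)"
    by (subst tendsto_cong[OF ev]) simp
  then show ?thesis
    by (simp add: has_derivative_iff_norm scaleC.bounded_linear_left)
qed

lemma spectrum_scaleC:
  fixes T :: "'a::complex_banach \<Rightarrow>\<^sub>L 'a"
  assumes T: "complex_linear T" and c: "c \<noteq> 0"
  shows "(\<lambda>w. w / c) ` spectrum T = spectrum ((1 / c) *\<^sub>C T)"
proof -
  have *: "\<exists>S. is_op_inverse ((c * w) *\<^sub>C id_blinfun - c *\<^sub>C A) S"
    if A: "complex_linear A" and c: "c \<noteq> 0" and S: "is_op_inverse (w *\<^sub>C id_blinfun - A) S"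
    for c w and A S :: "'a \<Rightarrow>\<^sub>L 'a"
  proof (intro exI)
    have eq: "(c * w) *\<^sub>C id_blinfun - c *\<^sub>C A = c *\<^sub>C (w *\<^sub>C id_blinfun - A)"
      by (simp add: scaleC.diff_right scaleC_scaleC)
    have cl: "complex_linear (w *\<^sub>C id_blinfun - A)"
      using A by (intro complex_linear_intros)
    show "is_op_inverse ((c * w) *\<^sub>C id_blinfun - c *\<^sub>C A) ((1 / c) *\<^sub>C S)"
      unfolding eq is_op_inverse_def scaleC_compose_left scaleC_compose_right[OF cl]
        scaleC_compose_right[OF complex_linear_inverse[OF S cl]]
      using S c by (simp add: is_op_inverse_def scaleC_scaleC)
  qed
  \<comment> \<open>The two inclusions are \<open>*\<close> for the factor \<open>1 / c\<close>
    applied to \<open>T\<close> and for the factor \<open>c\<close> applied to the scaled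
    operator.\<close>
  have eq: "w \<in> spectrum T \<longleftrightarrow> w / c \<in> spectrum ((1 / c) *\<^sub>C T)" for w
    using *[OF T, of "1 / c" w] *[OF complex_linear_scaleC[OF T], of c "w / c" "1 / c"] c
    by (auto simp: spectrum_def scaleC_scaleC)
  show ?thesis
  proof (intro set_eqI iffI)
    fix v assume "v \<in> spectrum ((1 / c) *\<^sub>C T)"
    then show "v \<in> (\<lambda>w. w / c) ` spectrum T"
      using eq[of "c * v"] c by (auto intro!: image_eqI[of _ _ "c * v"])
  qed (use eq in auto)
qed

section \<open>Integrals over circles\<close>

definition unit_circle :: "real \<Rightarrow> complex" where
  "unit_circle t = exp (2 * of_real pi * \<i> * of_real t)"

lemma unit_circle_0_1 [simp]: "unit_circle 0 = 1" "unit_circle 1 = 1"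
  by (simp_all add: unit_circle_def)

lemma norm_unit_circle [simp]: "cmod (unit_circle t) = 1"
  by (simp add: unit_circle_def norm_exp_eq_Re)

lemma continuous_on_unit_circle [continuous_intros]:
  "continuous_on S g \<Longrightarrow> continuous_on S (\<lambda>x. unit_circle (g x))"
  unfolding unit_circle_def by (intro continuous_intros)

lemma unit_circle_has_vector_derivative:
  "(unit_circle has_vector_derivative 2 * pi * \<i> * unit_circle t) (at t within S)"
proof -
  have "((\<lambda>t. exp (2 * of_real pi * \<i> * t)) has_field_derivative
      2 * pi * \<i> * exp (2 * of_real pi * \<i> * of_real t)) (at (of_real t))"
    by (auto intro!: derivative_eq_intros)
  from has_vector_derivative_real_field[OF this] show ?thesis
    unfolding unit_circle_def by (auto intro: has_vector_derivative_at_within)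
qed

lemma vec_contour_integral_circlepath:
  "vec_contour_integral (circlepath c r) F =
     integral {0..1} (\<lambda>t. (2 * pi * \<i> * r * unit_circle t) *\<^sub>C F (c + r * unit_circle t))"
  unfolding vec_contour_integral_def
  by (rule integral_cong)
     (simp only: vector_derivative_circlepath01 atLeastAtMost_iff, simp add: circlepath unit_circle_def)

text \<open>Since \<open>F\<close> is complex differentiable, the inner derivative \<open>g'\<close>
  joins the scalar \<open>a x\<close>. This makes the two mixed derivatives of a homotopy
  comparable.\<close>

lemma scaleC_has_vector_derivative:
  fixes F :: "complex \<Rightarrow> 'a::complex_banach"
  assumes F: "(F has_derivative (\<lambda>k. k *\<^sub>C D)) (at (g x))"
    and g: "(g has_vector_derivative g') (at x within S)"
    and a: "(a has_vector_derivative a') (at x within S)"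
  shows "((\<lambda>x. a x *\<^sub>C F (g x)) has_vector_derivative a' *\<^sub>C F (g x) + (a x * g') *\<^sub>C D) (at x within S)"
proof -
  have "((\<lambda>x. F (g x)) has_derivative (\<lambda>h. (h *\<^sub>R g') *\<^sub>C D)) (at x within S)"
    using has_derivative_compose[OF g[unfolded has_vector_derivative_def] F] .
  from scaleC.FDERIV[OF a[unfolded has_vector_derivative_def] this] show ?thesis
    unfolding has_vector_derivative_def
    by (rule has_derivative_eq_rhs)
       (auto simp: fun_eq_iff scaleR_add_right scaleC.scaleR_left scaleC.scaleR_right scaleC_scaleC add.commute)
qed

text \<open>
  With \<open>h s t = c s + r s * unit_circle t\<close>, the integrand is \<open>\<partial>\<^sub>t h *\<^sub>C F h\<close>, and its \<open>s\<close>-derivative equals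
  the \<open>t\<close>-derivative of \<open>\<partial>\<^sub>s h *\<^sub>C F h\<close>, which has integral zero by periodicity.
\<close>

lemma vec_contour_integral_circle_homotopy:
  fixes F :: "complex \<Rightarrow> 'a::complex_banach" and c :: "real \<Rightarrow> complex" and r :: "real \<Rightarrow> real"
  assumes F: "\<And>w. w \<in> D \<Longrightarrow> (F has_derivative (\<lambda>k. k *\<^sub>C F' w)) (at w)"
    and F': "continuous_on D F'"
    and c: "\<And>s. s \<in> {0..1} \<Longrightarrow> (c has_vector_derivative c' s) (at s within {0..1})"
    and r: "\<And>s. s \<in> {0..1} \<Longrightarrow> (r has_real_derivative r' s) (at s within {0..1})"
    and c': "continuous_on {0..1} c'" and r': "continuous_on {0..1} r'"
    and D: "\<And>s. s \<in> {0..1} \<Longrightarrow> sphere (c s) (r s) \<subseteq> D" and r0: "\<And>s. s \<in> {0..1} \<Longrightarrow> 0 \<le> r s"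
  shows "vec_contour_integral (circlepath (c 0) (r 0)) F = vec_contour_integral (circlepath (c 1) (r 1)) F"
proof -
  define h where "h s t = c s + r s * unit_circle t" for s t
  define \<theta> where "\<theta> = 2 * of_real pi * \<i>"
  define A where "A s t = (\<theta> * r s * unit_circle t) *\<^sub>C F (h s t)" for s t
  define A' where "A' s t = (\<theta> * r' s * unit_circle t) *\<^sub>C F (h s t)
      + ((\<theta> * r s * unit_circle t) * (c' s + r' s * unit_circle t)) *\<^sub>C F' (h s t)" for s t
  define B where "B s t = (c' s + r' s * unit_circle t) *\<^sub>C F (h s t)" for s t
  have hD: "h s t \<in> D" if "s \<in> {0..1}" for s t
    using D[OF that] r0[OF that] by (auto simp: h_def dist_norm norm_mult subset_iff)
  have contF: "continuous_on D F"
    using F has_derivative_continuous by (intro continuous_at_imp_continuous_on) blast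
  have cc: "continuous_on {0..1} c" and cr: "continuous_on {0..1} r"
    by (rule continuous_on_vector_derivative, erule c) (rule DERIV_continuous_on, erule r)
  have hs: "((\<lambda>s. h s t) has_vector_derivative (c' s + r' s * unit_circle t)) (at s within {0..1})"
    if "s \<in> {0..1}" for s t
    unfolding h_def using c[OF that] r[OF that]
    by (auto intro!: derivative_eq_intros has_vector_derivative_of_real)
  have ht: "(h s has_vector_derivative (\<theta> * r s * unit_circle t)) (at t within {0..1})" for s t
    unfolding h_def \<theta>_def
    by (auto intro!: derivative_eq_intros unit_circle_has_vector_derivative)
  have As: "((\<lambda>s. A s t) has_vector_derivative A' s t) (at s within {0..1})" if s: "s \<in> {0..1}" for s t
    unfolding A_def A'_def
    by (rule scaleC_has_vector_derivative[OF F[OF hD[OF s]] hs[OF s]])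
       (auto intro!: derivative_eq_intros has_vector_derivative_of_real r[OF s])
  have Bt: "(B s has_vector_derivative A' s t) (at t within {0..1})" if s: "s \<in> {0..1}" for s t
  proof -
    have "(B s has_vector_derivative (\<theta> * r' s * unit_circle t) *\<^sub>C F (h s t)
        + ((c' s + r' s * unit_circle t) * (\<theta> * r s * unit_circle t)) *\<^sub>C F' (h s t)) (at t within {0..1})"
      unfolding B_def
      by (rule scaleC_has_vector_derivative[OF F[OF hD[OF s]] ht])
         (auto intro!: derivative_eq_intros unit_circle_has_vector_derivative simp: \<theta>_def)
    then show ?thesis
      unfolding A'_def by (simp add: mult.commute)
  qed
  have comp: "continuous_on ({0..1} \<times> {0..1}) (\<lambda>(s, t). G (h s t))" if "continuous_on D G" for G :: "complex \<Rightarrow> 'a"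
    unfolding case_prod_beta
    by (rule continuous_on_compose2[OF that])
       (auto simp: hD[unfolded h_def] h_def[abs_def] intro!: continuous_intros continuous_on_compose2[OF cc] continuous_on_compose2[OF cr])
  have contA': "continuous_on ({0..1} \<times> cbox 0 1) (\<lambda>(s, t). A' s t)"
    unfolding A'_def case_prod_beta
    using comp[OF contF] comp[OF F']
    by (auto simp: case_prod_beta intro!: continuous_intros scaleC.continuous_on continuous_on_compose2[OF c']
        continuous_on_compose2[OF cr] continuous_on_compose2[OF r'])
  have contA: "continuous_on {0..1} (A s)" if s: "s \<in> {0..1}" for s
    unfolding A_def
    by (intro scaleC.continuous_on continuous_intros continuous_on_compose2[OF contF])
       (auto simp: hD[unfolded h_def] s[simplified] h_def[abs_def] intro!: continuous_intros)
  have "((\<lambda>s. integral {0..1} (A s)) has_vector_derivative 0) (at s within {0..1})" if s: "s \<in> {0..1}" for s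
  proof -
    have "(A' s has_integral B s 1 - B s 0) {0..1}"
      using Bt[OF s] by (intro fundamental_theorem_of_calculus) auto
    then have "integral {0..1} (A' s) = 0"
      by (simp add: B_def h_def integral_unique)
    then show ?thesis
      using leibniz_rule_vector_derivative[of "{0..1}" 0 1 A A' s] As contA' contA s
      by (auto simp: integrable_continuous_real)
  qed
  then obtain k where "\<And>s. s \<in> {0..1} \<Longrightarrow> integral {0..1} (A s) = k"
    using has_vector_derivative_zero_constant[of "{0..1::real}" "\<lambda>s. integral {0..1} (A s)"] by blast
  then have "integral {0..1} (A 0) = integral {0..1} (A 1)"
    by simp
  then show ?thesis
    by (simp add: vec_contour_integral_circlepath A_def[abs_def] h_def \<theta>_def)
qed

text \<open>A nonconstant Fourier mode has a periodic antiderivative. The exponent starts at 1,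
  since the constant mode has mean 1.\<close>

lemma integral_unit_circle_power:
  "((\<lambda>t. unit_circle t ^ Suc n) has_integral 0) {0..1}"
proof -
  let ?k = "2 * pi * \<i> * of_nat (Suc n)"
  have k: "?k \<noteq> 0"
    by (simp del: of_nat_Suc)
  have "((\<lambda>t. unit_circle t ^ Suc n / ?k) has_vector_derivative unit_circle t ^ Suc n) (at t within {0..1})" for t
  proof -
    have "((\<lambda>z. z ^ Suc n) has_field_derivative of_nat (Suc n) * unit_circle t ^ n)
        (at (unit_circle t) within unit_circle ` {0..1})"
      by (auto intro!: derivative_eq_intros simp del: of_nat_Suc power_Suc)
    from field_vector_diff_chain_within[OF unit_circle_has_vector_derivative this]
    have "((\<lambda>t. unit_circle t ^ Suc n) has_vector_derivative
        (2 * pi * \<i> * unit_circle t) * (of_nat (Suc n) * unit_circle t ^ n)) (at t within {0..1})"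
      by (simp add: o_def)
    from has_vector_derivative_divide[OF this, of ?k] show ?thesis
      using k by (simp add: field_simps del: of_nat_Suc)
  qed
  from fundamental_theorem_of_calculus[OF _ this] show ?thesis
    by simp
qed

section \<open>Integrals of the resolvent over a circle around the spectrum\<close>

context
  fixes T :: "'a::complex_banach \<Rightarrow>\<^sub>L 'a" and c :: complex and r :: real
  assumes T: "complex_linear T" and K: "spectrum T \<subseteq> ball c r" and r: "0 < r"
begin

lemma circle_in_resolvent_set: "r \<le> r' \<Longrightarrow> c + of_real r' * unit_circle t \<notin> spectrum T"
  using K r by (force simp: dist_norm norm_mult)

lemma continuous_on_resolvent_circle:
  "r \<le> r' \<Longrightarrow> continuous_on {0..1} (\<lambda>t. resolvent T (c + of_real r' * unit_circle t))"
  by (rule continuous_on_compose2[OF continuous_on_resolvent[OF T]])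
     (auto intro!: continuous_intros simp: circle_in_resolvent_set)

text \<open>Growing concentric circles stay off the spectrum, which lies in \<open>ball c r\<close>,
  so the linear change of radius is an admissible homotopy.\<close>

lemma circle_integral_resolvent_radius:
  assumes "r \<le> r'"
  shows "vec_contour_integral (circlepath c r) (resolvent T) = vec_contour_integral (circlepath c r') (resolvent T)"
proof -
  have *: "r \<le> r + s * (r' - r)" if "s \<in> {0..1}" for s
    using that assms by auto
  have "vec_contour_integral (circlepath c (r + 0 * (r' - r))) (resolvent T)
      = vec_contour_integral (circlepath c (r + 1 * (r' - r))) (resolvent T)"
  proof (rule vec_contour_integral_circle_homotopy[where D = "- spectrum T"
        and F' = "\<lambda>w. - (resolvent T w o\<^sub>L resolvent T w)" and c' = "\<lambda>_. 0" and r' = "\<lambda>_. r' - r"])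
    show "continuous_on (- spectrum T) (\<lambda>w. - (resolvent T w o\<^sub>L resolvent T w))"
      by (intro continuous_on_minus blinfun_compose.continuous_on continuous_on_resolvent[OF T])
    show "sphere c (r + s * (r' - r)) \<subseteq> - spectrum T" if "s \<in> {0..1}" for s
      using *[OF that] K by force
    show "0 \<le> r + s * (r' - r)" if "s \<in> {0..1}" for s
      using *[OF that] r by simp
  qed (auto intro!: has_derivative_resolvent[OF T] derivative_eq_intros)
  then show ?thesis by simp
qed

text \<open>Taking norms in \<open>scaleC_resolvent\<close>, where \<open>w - c\<close> has modulus
  \<open>r'\<close>, gives an inequality that can be solved for the norm of the resolvent.\<close>

lemma norm_resolvent_circle_le:
  assumes "r \<le> r'" "norm (T - c *\<^sub>C id_blinfun) < r'"
  shows "norm (resolvent T (c + of_real r' * unit_circle t)) \<le> 1 / (r' - norm (T - c *\<^sub>C id_blinfun))"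
proof -
  let ?w = "c + of_real r' * unit_circle t" and ?N = "T - c *\<^sub>C id_blinfun"
  have "r' * norm (resolvent T ?w) = norm ((?w - c) *\<^sub>C resolvent T ?w)"
    using assms(1) r by (simp add: norm_scaleC norm_mult)
  also have "\<dots> \<le> norm (id_blinfun :: 'a \<Rightarrow>\<^sub>L 'a) + norm (?N o\<^sub>L resolvent T ?w)"
    unfolding scaleC_resolvent[OF circle_in_resolvent_set[OF assms(1)]] by (rule norm_triangle_ineq)
  also have "\<dots> \<le> 1 + norm ?N * norm (resolvent T ?w)"
    by (intro add_mono norm_blinfun_id_le norm_blinfun_compose)
  finally show ?thesis
    using assms(2) by (simp add: field_simps)
qed

lemma circle_integral_resolvent:
  "vec_contour_integral (circlepath c r) (resolvent T) = (2 * pi * \<i>) *\<^sub>C id_blinfun"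
proof -
  let ?N = "T - c *\<^sub>C id_blinfun" and ?J = "vec_contour_integral (circlepath c r) (resolvent T)"
  let ?I = "(2 * pi * \<i>) *\<^sub>C id_blinfun :: 'a \<Rightarrow>\<^sub>L 'a"
  \<comment> \<open>The left side does not involve \<open>x\<close>, while the right side is the
    bound for the part \<open>?N o\<^sub>L resolvent T w\<close> of the integrand and decays like
    \<open>1 / x\<close>.\<close>
  have *: "norm (?J - ?I) \<le> 2 * pi * norm ?N * (1 / (x - norm ?N))"
    if x: "r \<le> x" "norm ?N < x" for x
  proof -
    let ?w = "\<lambda>t. c + of_real x * unit_circle t"
    define g where "g t = (2 * pi * \<i>) *\<^sub>C (?N o\<^sub>L resolvent T (?w t))" for t
    have "continuous_on {0..1} g"
      unfolding g_def using continuous_on_resolvent_circle[OF x(1)]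
      by (intro scaleC.continuous_on blinfun_compose.continuous_on continuous_on_const)
    then have int: "(g has_integral integral {0..1} g) {0..1}"
      by (intro integrable_integral integrable_continuous_real)
    have eq: "(2 * pi * \<i> * x * unit_circle t) *\<^sub>C resolvent T (?w t) = ?I + g t" for t
      using scaleC_resolvent[OF circle_in_resolvent_set[OF x(1)], of t c]
      by (simp add: g_def scaleC.add_right[symmetric] scaleC_scaleC[symmetric] mult.assoc)
    have "?J = vec_contour_integral (circlepath c x) (resolvent T)"
      by (rule circle_integral_resolvent_radius[OF x(1)])
    also have "\<dots> = integral {0..1} (\<lambda>t. ?I + g t)"
      by (simp only: vec_contour_integral_circlepath eq)
    also have "((\<lambda>t. ?I + g t) has_integral ?I + integral {0..1} g) {0..1}"
      using has_integral_add[OF has_integral_const_real[of ?I 0 1] int] by simp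
    then have "integral {0..1} (\<lambda>t. ?I + g t) = ?I + integral {0..1} g"
      by (rule integral_unique)
    finally have "?J - ?I = integral {0..1} g"
      by simp
    also have "norm \<dots> \<le> (2 * pi * norm ?N * (1 / (x - norm ?N))) * (1 - 0)"
    proof (rule integral_bound)
      fix t
      have "norm (g t) \<le> 2 * pi * (norm ?N * norm (resolvent T (?w t)))"
        by (simp add: g_def norm_scaleC norm_mult norm_blinfun_compose)
      also have "\<dots> \<le> 2 * pi * (norm ?N * (1 / (x - norm ?N)))"
        using norm_resolvent_circle_le[OF x, of t] by (intro mult_left_mono) auto
      finally show "norm (g t) \<le> 2 * pi * norm ?N * (1 / (x - norm ?N))"
        by (simp add: mult.assoc)
    qed (use \<open>continuous_on {0..1} g\<close> in auto)
    finally show ?thesis by simp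
  qed
  have "((\<lambda>x. 2 * pi * norm ?N * (1 / (x - norm ?N))) \<longlongrightarrow> 0) at_top"
    by real_asymp
  then have "norm (?J - ?I) \<le> 0"
    by (rule tendsto_lowerbound)
       (use * eventually_gt_at_top[of "max r (norm ?N)"] in \<open>auto elim!: eventually_mono\<close>)
  then show ?thesis by simp
qed

lemma circle_integral_power_resolvent:
  "vec_contour_integral (circlepath c r) (\<lambda>w. (w - c) ^ n *\<^sub>C resolvent T w)
    = (2 * pi * \<i>) *\<^sub>C op_power (T - c *\<^sub>C id_blinfun) n"
proof (induction n)
  case 0
  show ?case by (simp add: circle_integral_resolvent)
next
  case (Suc n)
  let ?N = "T - c *\<^sub>C id_blinfun" and ?w = "\<lambda>t. c + of_real r * unit_circle t"
  have N: "complex_linear ?N"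
    using T by (intro complex_linear_intros)
  define g where "g t = (2 * pi * \<i> * r * unit_circle t) *\<^sub>C ((?w t - c) ^ n *\<^sub>C resolvent T (?w t))" for t
  have "continuous_on {0..1} g"
    unfolding g_def using continuous_on_resolvent_circle[OF order_refl]
    by (intro scaleC.continuous_on continuous_intros)
  from integrable_integral[OF integrable_continuous_real[OF this]]
  have "(g has_integral (2 * pi * \<i>) *\<^sub>C op_power ?N n) {0..1}"
    using Suc.IH by (simp only: vec_contour_integral_circlepath g_def[abs_def])
  from has_integral_linear[OF this blinfun_compose.bounded_linear_right[of ?N]]
  have int: "((\<lambda>t. ?N o\<^sub>L g t) has_integral (2 * pi * \<i>) *\<^sub>C op_power ?N (Suc n)) {0..1}"
    by (simp add: o_def scaleC_compose_right[OF N])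
  \<comment> \<open>\<open>?k * unit_circle t ^ Suc n\<close> is \<open>(w - c) ^ n\<close> times
    the derivative of the circle: the contribution of the identity in
    \<open>scaleC_resolvent\<close>, with integral 0. Only the contribution of \<open>?N\<close>
    survives.\<close>
  let ?k = "2 * pi * \<i> * r ^ Suc n"
  have "((\<lambda>t. (?k * unit_circle t ^ Suc n) *\<^sub>C id_blinfun) has_integral 0) {0..1}"
    using has_integral_linear[OF has_integral_mult_right[OF integral_unit_circle_power[of n], of ?k]
        scaleC.bounded_linear_left[of id_blinfun]] by (simp add: o_def)
  from has_integral_add[OF this int]
  have "((\<lambda>t. (?k * unit_circle t ^ Suc n) *\<^sub>C id_blinfun + (?N o\<^sub>L g t))
      has_integral (2 * pi * \<i>) *\<^sub>C op_power ?N (Suc n)) {0..1}"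
    by (simp only: add_0_left)
  moreover have "(?k * unit_circle t ^ Suc n) *\<^sub>C id_blinfun + (?N o\<^sub>L g t)
      = (2 * pi * \<i> * r * unit_circle t) *\<^sub>C ((?w t - c) ^ Suc n *\<^sub>C resolvent T (?w t))" for t
  proof -
    have "(?k * unit_circle t ^ Suc n) *\<^sub>C id_blinfun + (?N o\<^sub>L g t)
        = (?k * unit_circle t ^ Suc n) *\<^sub>C (id_blinfun + (?N o\<^sub>L resolvent T (?w t)))"
      by (simp add: g_def scaleC_compose_right[OF N] scaleC_scaleC scaleC.add_right
          power_mult_distrib mult_ac)
    also have "\<dots> = (?k * unit_circle t ^ Suc n) *\<^sub>C ((?w t - c) *\<^sub>C resolvent T (?w t))"
      by (simp only: scaleC_resolvent[OF circle_in_resolvent_set[OF order_refl]])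
    finally show ?thesis
      by (simp add: scaleC_scaleC power_mult_distrib mult_ac)
  qed
  ultimately show ?case
    by (simp only: vec_contour_integral_circlepath integral_unique)
qed

theorem sums_circle_integral:
  assumes f: "\<And>w. w \<in> ball c R \<Longrightarrow> (\<lambda>n. a n * (w - c) ^ n) sums f w" and R: "r < R"
  shows "(\<lambda>n. a n *\<^sub>C op_power (T - c *\<^sub>C id_blinfun) n) sums
    ((1 / (2 * of_real pi * \<i>)) *\<^sub>C vec_contour_integral (circlepath c r) (\<lambda>w. f w *\<^sub>C resolvent T w))"
proof -
  let ?N = "T - c *\<^sub>C id_blinfun" and ?w = "\<lambda>t. c + of_real r * unit_circle t"
  let ?p = "\<lambda>t. 2 * pi * \<i> * r * unit_circle t"
  define g where "g n t = ?p t *\<^sub>C ((?w t - c) ^ n *\<^sub>C resolvent T (?w t))" for n t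
  define G where "G t = ?p t *\<^sub>C (f (?w t) *\<^sub>C resolvent T (?w t))" for t
  have contg: "continuous_on {0..1} (g n)" for n
    unfolding g_def using continuous_on_resolvent_circle[OF order_refl]
    by (intro scaleC.continuous_on continuous_intros)
  have intg: "integral {0..1} (g n) = (2 * pi * \<i>) *\<^sub>C op_power ?N n" for n
    using circle_integral_power_resolvent[of n] by (simp only: vec_contour_integral_circlepath g_def[abs_def])
  have "bounded ((\<lambda>t. resolvent T (?w t)) ` {0..1})"
    by (intro compact_imp_bounded compact_continuous_image continuous_on_resolvent_circle) auto
  then obtain M where M: "\<And>t. t \<in> {0..1} \<Longrightarrow> norm (resolvent T (?w t)) \<le> M"
    unfolding bounded_iff by blast
  have "summable (\<lambda>n. norm (a n * of_real r ^ n))"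
  proof (rule powser_insidea)
    \<comment> \<open>Convergence at the intermediate radius \<open>(r + R) / 2\<close> gives
      absolute convergence at radius \<open>r\<close>, hence the majorant for exchanging sum and
      integral.\<close>
    have "c + of_real ((r + R) / 2) \<in> ball c R"
      using R r by (simp add: dist_norm del: of_real_add of_real_divide)
    from sums_summable[OF f[OF this]] show "summable (\<lambda>n. a n * of_real ((r + R) / 2) ^ n)"
      by simp
    show "norm (complex_of_real r) < norm (complex_of_real ((r + R) / 2))"
      unfolding norm_of_real using R r by simp
  qed
  then have sm: "summable (\<lambda>n. 2 * pi * r * M * norm (a n * of_real r ^ n))"
    by (rule summable_mult)
  have bd: "norm (a n *\<^sub>C g n t) \<le> 2 * pi * r * M * norm (a n * of_real r ^ n)" if "t \<in> {0..1}" for n t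
  proof -
    have "norm (a n *\<^sub>C g n t) = 2 * pi * r * norm (a n * of_real r ^ n) * norm (resolvent T (?w t))"
      using r by (simp add: g_def norm_scaleC norm_mult norm_power)
    also have "\<dots> \<le> 2 * pi * r * norm (a n * of_real r ^ n) * M"
      using M[OF that] r by (intro mult_left_mono) auto
    finally show ?thesis by (simp add: mult_ac)
  qed
  have "(\<lambda>n. a n *\<^sub>C g n t) sums G t" for t
  proof -
    have "?w t \<in> ball c R"
      using R r by (simp add: dist_norm norm_mult)
    from bounded_linear.sums[OF scaleC.bounded_linear_left f[OF this]]
    have "(\<lambda>n. (a n * (?w t - c) ^ n) *\<^sub>C resolvent T (?w t)) sums (f (?w t) *\<^sub>C resolvent T (?w t))" .
    from bounded_linear.sums[OF bounded_linear_scaleC this, of "?p t"] show ?thesis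
      by (simp add: G_def g_def scaleC_scaleC mult_ac)
  qed
  then have "G = (\<lambda>t. \<Sum>n. a n *\<^sub>C g n t)"
    by (intro ext sums_unique)
  then have "uniform_limit {0..1} (\<lambda>k t. \<Sum>n<k. a n *\<^sub>C g n t) G sequentially"
    by (simp only:) (rule Weierstrass_m_test[OF bd sm])
  then obtain I J where I: "\<And>k. ((\<lambda>t. \<Sum>n<k. a n *\<^sub>C g n t) has_integral I k) {0..1}"
    and J: "(G has_integral J) {0..1}" and lim: "I \<longlonglongrightarrow> J"
    by (rule uniform_limit_integral)
       (auto intro!: continuous_on_sum bounded_linear.continuous_on[OF bounded_linear_scaleC] contg)
  have "((\<lambda>t. \<Sum>n<k. a n *\<^sub>C g n t) has_integral (\<Sum>n<k. a n *\<^sub>C ((2 * pi * \<i>) *\<^sub>C op_power ?N n))) {0..1}" for k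
  proof (rule has_integral_sum)
    fix n
    have "(g n has_integral (2 * pi * \<i>) *\<^sub>C op_power ?N n) {0..1}"
      using integrable_integral[OF integrable_continuous_real[OF contg[of n]]] intg by simp
    from has_integral_linear[OF this bounded_linear_scaleC, of "a n"]
    show "((\<lambda>t. a n *\<^sub>C g n t) has_integral a n *\<^sub>C ((2 * pi * \<i>) *\<^sub>C op_power ?N n)) {0..1}"
      by (simp add: o_def)
  qed simp
  then have "I = (\<lambda>k. \<Sum>n<k. a n *\<^sub>C ((2 * pi * \<i>) *\<^sub>C op_power ?N n))"
    using I has_integral_unique by blast
  then have "(\<lambda>n. a n *\<^sub>C ((2 * pi * \<i>) *\<^sub>C op_power ?N n)) sums J"
    using lim by (simp add: sums_def)
  from bounded_linear.sums[OF bounded_linear_scaleC this, of "1 / (2 * pi * \<i>)"]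
  have "(\<lambda>n. a n *\<^sub>C op_power ?N n) sums ((1 / (2 * pi * \<i>)) *\<^sub>C J)"
    by (simp add: scaleC_scaleC)
  moreover have "J = vec_contour_integral (circlepath c r) (\<lambda>w. f w *\<^sub>C resolvent T w)"
    using integral_unique[OF J] by (simp only: vec_contour_integral_circlepath G_def[abs_def])
  ultimately show ?thesis by simp
qed

end

section \<open>From one circle to the functional calculus\<close>

lemma surrounds_circlepath:
  assumes "K \<subseteq> ball c r" "0 < r" "r < R"
  shows "surrounds [circlepath c r] K (ball c R)"
proof -
  have "winding_number (circlepath c r) w = 0" if "w \<notin> ball c R" for w
    by (rule winding_number_zero_outside[of _ "cball c r"]) (use that assms in auto)
  moreover have "winding_number (circlepath c r) w = 1" if "w \<in> K" for w
    using that assms by (intro winding_number_circlepath) (auto simp: dist_norm norm_minus_commute)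
  ultimately show ?thesis
    using assms by (auto simp: surrounds_def)
qed

text \<open>This leaves room for a circle between the spectrum and the boundary of the disc. The
  empty set has to be covered, because the spectrum is empty on the zero space.\<close>

lemma compact_subset_ball_radius:
  fixes c :: "'a::metric_space"
  assumes "compact K" "K \<subseteq> ball c R" "0 < R"
  obtains r where "0 < r" "r < R" "K \<subseteq> ball c r"
proof (cases "K = {}")
  case True
  then show ?thesis using that[of "R / 2"] assms by auto
next
  case False
  then obtain x where x: "x \<in> K" "\<And>y. y \<in> K \<Longrightarrow> dist c y \<le> dist c x"
    using continuous_attains_sup[OF assms(1) False continuous_on_dist[OF continuous_on_const continuous_on_id]]
    by blast
  have "dist c x < R"
    using x(1) assms by auto
  then obtain r where r: "dist c x < r" "r < R"
    using dense by blast
  with x(2) show ?thesis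
    by (intro that[of r] subsetI) (auto intro: le_less_trans[OF zero_le_dist] le_less_trans)
qed

lemma compact_spectrum:
  "complex_linear T \<Longrightarrow> spectrum T \<subseteq> ball c R \<Longrightarrow> compact (spectrum T)"
  using closed_spectrum bounded_subset[OF bounded_ball] compact_eq_bounded_closed by blast

lemma has_fun_calc_power_series:
  fixes T :: "'a::complex_banach \<Rightarrow>\<^sub>L 'a"
  assumes T: "complex_linear T" and K: "spectrum T \<subseteq> ball c R" and R: "0 < R"
    and hol: "f holomorphic_on ball c R"
    and f: "\<And>w. w \<in> ball c R \<Longrightarrow> (\<lambda>n. a n * (w - c) ^ n) sums f w"
  shows "\<exists>S. has_fun_calc f T S \<and> (\<lambda>n. a n *\<^sub>C op_power (T - c *\<^sub>C id_blinfun) n) sums S"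
proof -
  obtain r where r: "0 < r" "r < R" "spectrum T \<subseteq> ball c r"
    using compact_subset_ball_radius[OF compact_spectrum[OF T K] K R] by blast
  show ?thesis
    unfolding has_fun_calc_def
  proof (intro exI conjI)
    show "surrounds [circlepath c r] (spectrum T) (ball c R)"
      by (rule surrounds_circlepath) fact+
    show "(\<lambda>n. a n *\<^sub>C op_power (T - c *\<^sub>C id_blinfun) n) sums
        ((1 / (2 * of_real pi * \<i>)) *\<^sub>C (\<Sum>\<gamma>\<leftarrow>[circlepath c r]. vec_contour_integral \<gamma> (\<lambda>w. f w *\<^sub>C resolvent T w)))"
      using sums_circle_integral[OF T r(3,1), of R a f] f r(2) by simp
  qed (use K hol in auto)
qed

section \<open>Moving the circle between two half-planes\<close>

lemma vec_contour_integral_circlepath_cong: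
  assumes "0 \<le> r" "\<And>w. w \<in> sphere c r \<Longrightarrow> F w = G w"
  shows "vec_contour_integral (circlepath c r) F = vec_contour_integral (circlepath c r) G"
  unfolding vec_contour_integral_circlepath
  using assms by (intro integral_cong) (simp add: dist_norm norm_mult)

lemma cmod_diff_square: "(cmod (w - c))\<^sup>2 = (cmod w)\<^sup>2 - 2 * Re (w * cnj c) + (cmod c)\<^sup>2"
  by (simp only: cmod_power2) (simp add: power2_eq_square algebra_simps)

text \<open>For a disc with the origin on its boundary the term \<open>(cmod c)\<^sup>2\<close>
  cancels, so the condition on the centre is linear.\<close>

lemma ball_norm_iff: "w \<in> ball c (cmod c) \<longleftrightarrow> (cmod w)\<^sup>2 < 2 * Re (w * cnj c)"
proof -
  have "w \<in> ball c (cmod c) \<longleftrightarrow> (cmod (w - c))\<^sup>2 < (cmod c)\<^sup>2"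
    by (simp add: dist_norm norm_minus_commute) (auto intro: power_strict_mono power2_less_imp_less)
  then show ?thesis
    unfolding cmod_diff_square by simp
qed

lemma ball_norm_subset_half_plane: "ball c (cmod c) \<subseteq> {w. 0 < Re (w * cnj c)}"
proof
  fix w assume "w \<in> ball c (cmod c)"
  then have "(cmod w)\<^sup>2 < 2 * Re (w * cnj c)"
    by (simp only: ball_norm_iff)
  with zero_le_power2[of "cmod w"] show "w \<in> {w. 0 < Re (w * cnj c)}"
    unfolding mem_Collect_eq by linarith
qed

lemma open_half_plane_cnj: "open {w. 0 < Re (w * cnj c)}"
  by (intro open_Collect_less continuous_intros)

lemma compact_positive_lower_bound:
  fixes f :: "'a::topological_space \<Rightarrow> real"
  assumes "compact K" "K \<noteq> {}" "continuous_on K f" "\<And>x. x \<in> K \<Longrightarrow> 0 < f x"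
  obtains m where "0 < m" "\<And>x. x \<in> K \<Longrightarrow> m < f x"
proof -
  obtain x where "x \<in> K" "\<And>y. y \<in> K \<Longrightarrow> f x \<le> f y"
    using continuous_attains_inf[OF assms(1-3)] by blast
  with assms(4)[of x] show ?thesis
    by (intro that[of "f x / 2"]) fastforce+
qed

text \<open>
  For fixed \<open>\<eta>\<close> the condition \<open>(cmod (w - c))\<^sup>2 < (cmod c)\<^sup>2 - \<eta>\<close> is linear in \<open>c\<close>, and it implies
  \<open>0 < Re (w * cnj c)\<close>. So the centre moves along the segment from \<open>\<rho>\<close> to a large multiple of \<open>d\<close>. The
  point \<open>p\<close> keeps the radius positive even if the spectrum is empty.
\<close>

theorem has_fun_calc_two_half_planes:
  fixes T :: "'a::complex_banach \<Rightarrow>\<^sub>L 'a" and \<rho> d :: complex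
  assumes T: "complex_linear T" and K: "spectrum T \<subseteq> ball \<rho> (cmod \<rho>)"
    and f: "f holomorphic_on {w. 0 < Re (w * cnj \<rho>)}" and g: "g holomorphic_on {w. 0 < Re (w * cnj d)}"
    and fg: "\<And>w. 0 < Re (w * cnj \<rho>) \<Longrightarrow> 0 < Re (w * cnj d) \<Longrightarrow> f w = g w"
    and d: "cmod d = 1" "0 < cmod \<rho> + Re (\<rho> * cnj d)" and \<rho>: "\<rho> \<noteq> 0"
    and Kd: "\<And>w. w \<in> spectrum T \<Longrightarrow> 0 < Re (w * cnj d)"
    and a: "\<And>w. w \<in> ball \<rho> (cmod \<rho>) \<Longrightarrow> (\<lambda>n. a n * (w - \<rho>) ^ n) sums f w"
  shows "\<exists>S. has_fun_calc g T S \<and> (\<lambda>n. a n *\<^sub>C op_power (T - \<rho> *\<^sub>C id_blinfun) n) sums S"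
proof -
  let ?A = "{w. 0 < Re (w * cnj \<rho>)}" and ?B = "{w. 0 < Re (w * cnj d)}"
  \<comment> \<open>The midpoint of \<open>\<rho>\<close> and the point of equal modulus in
    direction \<open>d\<close>. It satisfies the conditions of both half-planes strictly, because
    \<open>d(2)\<close> says that \<open>d\<close> is not opposite to \<open>\<rho>\<close>.\<close>
  define p where "p = (\<rho> + cmod \<rho> * d) / 2"
  define K' where "K' = insert p (spectrum T)"
  have dd: "d * cnj d = 1"
    using d(1) by (simp add: complex_norm_square[symmetric])
  have \<rho>\<rho>: "\<rho> * cnj \<rho> = of_real ((cmod \<rho>)\<^sup>2)"
    by (rule complex_norm_square[symmetric])
  have Re_d\<rho>: "Re (d * cnj \<rho>) = Re (\<rho> * cnj d)"
    by (simp add: algebra_simps)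
  have p\<rho>: "2 * Re (p * cnj \<rho>) = cmod \<rho> * (cmod \<rho> + Re (\<rho> * cnj d))"
  proof -
    have "2 * (p * cnj \<rho>) = \<rho> * cnj \<rho> + cmod \<rho> * (d * cnj \<rho>)"
      by (simp add: p_def algebra_simps)
    from arg_cong[OF this, of Re] show ?thesis
      unfolding \<rho>\<rho> using Re_d\<rho> by (simp add: power2_eq_square algebra_simps)
  qed
  have pd: "2 * Re (p * cnj d) = cmod \<rho> + Re (\<rho> * cnj d)"
  proof -
    have "2 * (p * cnj d) = \<rho> * cnj d + cmod \<rho> * (d * cnj d)"
      by (simp add: p_def algebra_simps)
    from arg_cong[OF this, of Re] show ?thesis
      unfolding dd by simp
  qed
  have pp: "2 * (cmod p)\<^sup>2 = cmod \<rho> * (cmod \<rho> + Re (\<rho> * cnj d))"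
  proof -
    have "4 * (p * cnj p) = \<rho> * cnj \<rho> + cmod \<rho> * (d * cnj \<rho> + \<rho> * cnj d) + (cmod \<rho>)\<^sup>2 * (d * cnj d)"
      by (simp add: p_def algebra_simps power2_eq_square)
    from arg_cong[OF this, of Re] show ?thesis
      unfolding \<rho>\<rho> dd complex_norm_square[symmetric] using Re_d\<rho> d(1)
      by (simp add: power2_eq_square algebra_simps)
  qed
  have pos: "0 < cmod \<rho> * (cmod \<rho> + Re (\<rho> * cnj d))"
    using d(2) \<rho> by simp
  have K'\<rho>: "0 < 2 * Re (w * cnj \<rho>) - (cmod w)\<^sup>2" if "w \<in> K'" for w
  proof (cases "w = p")
    case True
    show ?thesis
      using pos unfolding True p\<rho> pp[symmetric] by linarith
  next
    case False
    then have "w \<in> ball \<rho> (cmod \<rho>)"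
      using that K by (auto simp: K'_def)
    then show ?thesis
      unfolding ball_norm_iff by linarith
  qed
  have K'd: "0 < Re (w * cnj d)" if "w \<in> K'" for w
    using that Kd pd d(2) by (auto simp: K'_def)
  have K': "compact K'" "K' \<noteq> {}"
    unfolding K'_def using compact_spectrum[OF T K] by auto
  obtain \<eta> where \<eta>: "0 < \<eta>" "\<And>w. w \<in> K' \<Longrightarrow> \<eta> < 2 * Re (w * cnj \<rho>) - (cmod w)\<^sup>2"
    by (rule compact_positive_lower_bound[OF K' _ K'\<rho>]) (auto intro!: continuous_intros)
  obtain m where m: "0 < m" "\<And>w. w \<in> K' \<Longrightarrow> m < Re (w * cnj d)"
    by (rule compact_positive_lower_bound[OF K' _ K'd]) (auto intro!: continuous_intros)
  obtain b where b: "\<And>w. w \<in> K' \<Longrightarrow> cmod w \<le> b"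
    using compact_imp_bounded[OF K'(1)] unfolding bounded_iff by blast
  \<comment> \<open>Chosen so that \<open>2 * (M * m) = b\<^sup>2 + \<eta>\<close>: then the gap
    \<open>\<eta>\<close> that holds for the centre \<open>\<rho>\<close> also holds for the centre
    \<open>M * d\<close>.\<close>
  define M where "M = (b\<^sup>2 + \<eta>) / (2 * m)"
  have M0: "0 < M"
    unfolding M_def using \<eta>(1) m(1) by (intro divide_pos_pos add_nonneg_pos) auto
  have M: "\<eta> < 2 * (M * Re (w * cnj d)) - (cmod w)\<^sup>2" if "w \<in> K'" for w
  proof -
    have "(cmod w)\<^sup>2 + \<eta> \<le> b\<^sup>2 + \<eta>"
      using b[OF that] by (simp add: power_mono)
    also have "\<dots> = 2 * (M * m)"
      using m(1) by (simp add: M_def)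
    also have "\<dots> < 2 * (M * Re (w * cnj d))"
      using m(2)[OF that] M0 by simp
    finally show ?thesis by simp
  qed
  define v where "v = M * d - \<rho>"
  define c where "c s = \<rho> + of_real s * v" for s :: real
  \<comment> \<open>The squared radius \<open>(cmod (c s))\<^sup>2 - \<eta>\<close>, written in real
    coordinates to be differentiated in \<open>s\<close>.\<close>
  define q where "q s = (Re \<rho> + s * Re v)\<^sup>2 + (Im \<rho> + s * Im v)\<^sup>2 - \<eta>" for s
  define q' where "q' s = 2 * (Re \<rho> + s * Re v) * Re v + 2 * (Im \<rho> + s * Im v) * Im v" for s
  define r where "r s = sqrt (q s)" for s
  have q: "q s = (cmod (c s))\<^sup>2 - \<eta>" for s
    by (simp add: q_def c_def cmod_power2)
  have Re_c: "Re (w * cnj (c s)) = (1 - s) * Re (w * cnj \<rho>) + s * (M * Re (w * cnj d))" for w s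
    by (simp add: c_def v_def algebra_simps)
  have B_iff: "0 < Re (w * cnj (c 1)) \<longleftrightarrow> 0 < Re (w * cnj d)" for w
    unfolding Re_c using M0 by (simp add: zero_less_mult_iff)
  \<comment> \<open>\<open>Re (w * cnj (c s))\<close> is affine in \<open>s\<close>, so the two gaps
    at the ends combine convexly into the gap at \<open>s\<close>.\<close>
  have K'c: "(cmod (w - c s))\<^sup>2 < q s" if "w \<in> K'" "s \<in> {0..1}" for w s
  proof -
    have "(1 - s) * - (2 * Re (w * cnj \<rho>)) + s * - (2 * (M * Re (w * cnj d))) < - (\<eta> + (cmod w)\<^sup>2)"
      using \<eta>(2)[OF that(1)] M[OF that(1)] that(2) by (intro convex_bound_lt) auto
    then show ?thesis
      unfolding cmod_diff_square q Re_c by (simp add: algebra_simps)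
  qed
  have q0: "0 < q s" if "s \<in> {0..1}" for s
    using le_less_trans[OF zero_le_power2 K'c[OF _ that, of p]] by (simp add: K'_def)
  have r0: "0 < r s" if "s \<in> {0..1}" for s
    using q0[OF that] by (simp add: r_def)
  have Kr: "spectrum T \<subseteq> ball (c s) (r s)" if "s \<in> {0..1}" for s
    using K'c[OF _ that] by (auto simp: K'_def r_def dist_norm norm_minus_commute real_less_rsqrt)
  have r_less: "r s < cmod (c s)" for s
    unfolding r_def q using \<eta>(1) by (intro real_less_lsqrt) auto
  have c01: "c 0 = \<rho>" "c 1 = M * d"
    by (simp_all add: c_def v_def)
  define h where "h = (\<lambda>w. if w \<in> ?A then f w else g w)"
  have hol: "h holomorphic_on ?A \<union> ?B"
    unfolding h_def using fg by (intro holomorphic_on_If_Un f g open_half_plane_cnj) auto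
  have opn: "open (?A \<union> ?B)"
    by (intro open_Un open_half_plane_cnj)
  let ?D = "(?A \<union> ?B) - spectrum T"
  let ?R = "resolvent T"
  \<comment> \<open>On the circle \<open>Re (u * cnj (c s))\<close> is positive and is a
    combination, with nonnegative weights, of the forms defining the two half-planes; hence one of
    them is positive, and \<open>h\<close> is holomorphic there.\<close>
  have sph: "sphere (c s) (r s) \<subseteq> ?D" if s: "s \<in> {0..1}" for s
  proof
    fix u assume u: "u \<in> sphere (c s) (r s)"
    then have "(cmod (u - c s))\<^sup>2 = q s"
      using q0[OF s] by (simp add: r_def dist_norm norm_minus_commute)
    then have "2 * Re (u * cnj (c s)) = (cmod u)\<^sup>2 + \<eta>"
      unfolding cmod_diff_square q by simp
    then have "0 < (1 - s) * Re (u * cnj \<rho>) + s * (M * Re (u * cnj d))"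
      using add_nonneg_pos[OF zero_le_power2 \<eta>(1), of "cmod u"] unfolding Re_c[symmetric] by linarith
    then have "0 < Re (u * cnj \<rho>) \<or> 0 < Re (u * cnj d)"
      using s M0 by (smt (verit) atLeastAtMost_iff mult_nonneg_nonpos)
    moreover have "u \<notin> spectrum T"
      using u Kr[OF s] by auto
    ultimately show "u \<in> ?D" by blast
  qed
  have "vec_contour_integral (circlepath (c 0) (r 0)) (\<lambda>w. h w *\<^sub>C ?R w)
      = vec_contour_integral (circlepath (c 1) (r 1)) (\<lambda>w. h w *\<^sub>C ?R w)"
  proof (rule vec_contour_integral_circle_homotopy[where D = ?D and c' = "\<lambda>_. v"
        and F' = "\<lambda>w. h w *\<^sub>C (- (?R w o\<^sub>L ?R w)) + deriv h w *\<^sub>C ?R w"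
        and r' = "\<lambda>s. q' s / (2 * sqrt (q s))"])
    fix w assume w: "w \<in> ?D"
    then have "(h has_derivative (\<lambda>k. deriv h w * k)) (at w)"
      using holomorphic_derivI[OF hol opn] by (auto simp: has_field_derivative_def)
    from scaleC.FDERIV[OF this has_derivative_resolvent[OF T]] w
    show "((\<lambda>w. h w *\<^sub>C ?R w) has_derivative
        (\<lambda>k. k *\<^sub>C (h w *\<^sub>C (- (?R w o\<^sub>L ?R w)) + deriv h w *\<^sub>C ?R w))) (at w)"
      by (auto simp: scaleC.add_right scaleC_scaleC mult.commute)
  next
    have "continuous_on ?D h" "continuous_on ?D (deriv h)" "continuous_on ?D ?R"
      by (auto intro: continuous_on_subset[OF holomorphic_on_imp_continuous_on[OF hol]]
          continuous_on_subset[OF holomorphic_on_imp_continuous_on[OF holomorphic_deriv[OF hol opn]]]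
          continuous_on_subset[OF continuous_on_resolvent[OF T]])
    then show "continuous_on ?D (\<lambda>w. h w *\<^sub>C (- (?R w o\<^sub>L ?R w)) + deriv h w *\<^sub>C ?R w)"
      by (intro continuous_on_add continuous_on_minus scaleC.continuous_on blinfun_compose.continuous_on)
  next
    fix s :: real assume s: "s \<in> {0..1}"
    show "(c has_vector_derivative v) (at s within {0..1})"
      unfolding c_def by (auto intro!: derivative_eq_intros has_vector_derivative_of_real)
    have "(q has_real_derivative q' s) (at s within {0..1})"
      unfolding q_def q'_def by (auto intro!: derivative_eq_intros simp: algebra_simps)
    then show "(r has_real_derivative q' s / (2 * sqrt (q s))) (at s within {0..1})"
      unfolding r_def using q0[OF s] by (auto intro!: derivative_eq_intros simp: divide_simps)
    show "sphere (c s) (r s) \<subseteq> ?D" "0 \<le> r s"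
      using sph[OF s] r0[OF s] by auto
  next
    have "sqrt (q s) \<noteq> 0" if "s \<in> {0..1}" for s
      using q0[OF that] by simp
    then show "continuous_on {0..1} (\<lambda>s. q' s / (2 * sqrt (q s)))"
      unfolding q_def q'_def by (intro continuous_intros) auto
  qed auto
  also have "vec_contour_integral (circlepath (c 0) (r 0)) (\<lambda>w. h w *\<^sub>C ?R w)
      = vec_contour_integral (circlepath (c 0) (r 0)) (\<lambda>w. f w *\<^sub>C ?R w)"
  proof (rule vec_contour_integral_circlepath_cong)
    fix w assume "w \<in> sphere (c 0) (r 0)"
    then have "w \<in> ball \<rho> (cmod \<rho>)"
      using r_less[of 0] by (simp add: c01)
    then have "w \<in> ?A"
      using ball_norm_subset_half_plane by blast
    then show "h w *\<^sub>C ?R w = f w *\<^sub>C ?R w"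
      by (simp add: h_def)
  qed (use r0[of 0] in simp)
  also have "vec_contour_integral (circlepath (c 1) (r 1)) (\<lambda>w. h w *\<^sub>C ?R w)
      = vec_contour_integral (circlepath (c 1) (r 1)) (\<lambda>w. g w *\<^sub>C ?R w)"
  proof (rule vec_contour_integral_circlepath_cong)
    fix w assume "w \<in> sphere (c 1) (r 1)"
    then have "w \<in> ball (c 1) (cmod (c 1))"
      using r_less[of 1] by simp
    then have "0 < Re (w * cnj (c 1))"
      using ball_norm_subset_half_plane by blast
    then have "w \<in> ?B"
      unfolding B_iff by (rule CollectI)
    then show "h w *\<^sub>C ?R w = g w *\<^sub>C ?R w"
      using fg by (simp add: h_def)
  qed (use r0[of 1] in simp)
  finally have eq: "vec_contour_integral (circlepath (c 0) (r 0)) (\<lambda>w. f w *\<^sub>C ?R w)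
      = vec_contour_integral (circlepath (c 1) (r 1)) (\<lambda>w. g w *\<^sub>C ?R w)" .
  have ball_B: "ball (c 1) (cmod (c 1)) \<subseteq> ?B"
    using ball_norm_subset_half_plane[of "c 1"] unfolding B_iff .
  have "has_fun_calc g T ((1 / (2 * of_real pi * \<i>)) *\<^sub>C
      vec_contour_integral (circlepath (c 1) (r 1)) (\<lambda>w. g w *\<^sub>C ?R w))"
    unfolding has_fun_calc_def
  proof (intro exI conjI)
    show "surrounds [circlepath (c 1) (r 1)] (spectrum T) (ball (c 1) (cmod (c 1)))"
      by (intro surrounds_circlepath Kr r0 r_less) auto
    show "g holomorphic_on ball (c 1) (cmod (c 1))"
      by (rule holomorphic_on_subset[OF g ball_B])
    show "spectrum T \<subseteq> ball (c 1) (cmod (c 1))"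
      using Kr[of 1] subset_ball[of "r 1" "cmod (c 1)"] r_less[of 1] by force
  qed simp_all
  moreover have "(\<lambda>n. a n *\<^sub>C op_power (T - \<rho> *\<^sub>C id_blinfun) n) sums
      ((1 / (2 * of_real pi * \<i>)) *\<^sub>C vec_contour_integral (circlepath (c 0) (r 0)) (\<lambda>w. f w *\<^sub>C ?R w))"
    using sums_circle_integral[OF T Kr[of 0] r0[of 0], of "cmod \<rho>" a f] a r_less[of 0]
    by (simp add: c01)
  ultimately show ?thesis
    unfolding eq by blast
qed

section \<open>Branches of the power function\<close>

text \<open>\<open>Ln\<close> is additive on the product \<open>\<rho> * (w / \<rho>)\<close> as
  long as the sum of the arguments stays in the principal range.\<close>

lemma powr_branch_eq_powr:
  assumes "\<rho> \<noteq> 0" "w \<noteq> 0" "- pi < Arg \<rho> + Arg (w / \<rho>)" "Arg \<rho> + Arg (w / \<rho>) \<le> pi"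
  shows "powr_branch \<rho> \<alpha> w = w powr \<alpha>"
proof -
  have "Ln (\<rho> * (w / \<rho>)) = Ln \<rho> + Ln (w / \<rho>)"
    using assms by (intro Ln_times_simple) (auto simp: Arg_eq_Im_Ln)
  then show ?thesis
    using assms(1,2) by (simp add: powr_branch_def powr_def exp_add[symmetric] algebra_simps)
qed

lemma powr_branch_Ints:
  assumes "\<rho> \<noteq> 0" "w \<noteq> 0" "\<alpha> \<in> \<int>"
  shows "powr_branch \<rho> \<alpha> w = w powr \<alpha>"
proof -
  obtain k where "\<alpha> = of_int k"
    using assms(3) by (auto elim: Ints_cases)
  then show ?thesis
    using assms(1,2) by (simp add: powr_branch_def complex_powr_of_int power_int_divide_distrib)
qed

lemma Re_divide_pos_iff: "c \<noteq> 0 \<Longrightarrow> 0 < Re (w / c) \<longleftrightarrow> 0 < Re (w * cnj c)"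
  unfolding complex_div_cnj[of w c] of_real_power[symmetric] Re_divide_of_real
  by (simp only: zero_less_divide_iff) simp

lemma abs_Arg_divide_less:
  assumes "c \<noteq> 0" "0 < Re (w * cnj c)"
  shows "\<bar>Arg (w / c)\<bar> < pi / 2"
  using assms Re_divide_pos_iff Arg_Re_pos by blast

lemma powr_branch_holomorphic:
  assumes "\<rho> \<noteq> 0"
  shows "powr_branch \<rho> \<alpha> holomorphic_on {w. 0 < Re (w * cnj \<rho>)}"
proof -
  have "w / \<rho> \<notin> \<real>\<^sub>\<le>\<^sub>0" if "0 < Re (w * cnj \<rho>)" for w
    using that assms Re_divide_pos_iff[of \<rho> w] by (auto simp: complex_nonpos_Reals_iff)
  then show ?thesis
    unfolding powr_branch_def using assms by (auto intro!: holomorphic_intros)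
qed

lemma powr_branch_sums:
  assumes "w \<in> ball \<rho> (cmod \<rho>)"
  shows "(\<lambda>n. (\<rho> powr \<alpha> * (\<alpha> gchoose n) / \<rho> ^ n) * (w - \<rho>) ^ n) sums powr_branch \<rho> \<alpha> w"
proof -
  have \<rho>: "\<rho> \<noteq> 0" using assms by auto
  have "norm ((w - \<rho>) / \<rho>) < 1"
    using assms \<rho> by (simp add: dist_norm norm_divide norm_minus_commute)
  from sums_mult[OF gen_binomial_complex[OF this, of \<alpha>], of "\<rho> powr \<alpha>"] show ?thesis
    using \<rho> by (simp add: powr_branch_def power_divide add_divide_eq_iff mult_ac)
qed

text \<open>The sum of arguments is positive, so it could only leave the principal range above pi.
  It would then wrap by \<open>2 * pi\<close> to a negative \<open>Arg w\<close>, against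
  \<open>0 < Im w\<close>.\<close>

lemma powr_branch_eq_powr_upper:
  assumes "pi / 2 < Arg \<rho>" "0 < Re (w * cnj \<rho>)" "0 < Im w"
  shows "powr_branch \<rho> \<alpha> w = w powr \<alpha>"
proof -
  have \<rho>: "\<rho> \<noteq> 0" and w: "w \<noteq> 0" using assms by auto
  have "\<bar>Arg (w / \<rho>)\<bar> < pi / 2"
    by (rule abs_Arg_divide_less[OF \<rho> assms(2)])
  moreover have "Arg \<rho> + Arg (w / \<rho>) \<le> pi"
  proof (rule ccontr)
    assume "\<not> ?thesis"
    then have "Arg (\<rho> * (w / \<rho>)) = Arg \<rho> + Arg (w / \<rho>) - 2 * pi"
      using \<rho> w by (subst Arg_times') auto
    then have "Arg w < 0"
      using \<rho> calculation Arg_le_pi[of \<rho>] by simp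
    with assms(3) show False by (simp add: Arg_neg_iff)
  qed
  ultimately show ?thesis
    using assms(1) \<rho> w by (intro powr_branch_eq_powr) auto
qed

text \<open>Mirror image of the upper case, except that the sum -pi itself also wraps; it gives
  \<open>Arg w = pi\<close>, which is still positive.\<close>

lemma powr_branch_eq_powr_lower:
  assumes "Arg \<rho> < - pi / 2" "0 < Re (w * cnj \<rho>)" "Im w < 0"
  shows "powr_branch \<rho> \<alpha> w = w powr \<alpha>"
proof -
  have \<rho>: "\<rho> \<noteq> 0" and w: "w \<noteq> 0" using assms by auto
  have "\<bar>Arg (w / \<rho>)\<bar> < pi / 2"
    by (rule abs_Arg_divide_less[OF \<rho> assms(2)])
  moreover have "- pi < Arg \<rho> + Arg (w / \<rho>)"
  proof (rule ccontr)
    assume "\<not> ?thesis"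
    then have "Arg (\<rho> * (w / \<rho>)) = Arg \<rho> + Arg (w / \<rho>) + 2 * pi"
      using \<rho> w calculation assms(1) by (subst Arg_times') auto
    then have "0 < Arg w"
      using \<rho> calculation mpi_less_Arg[of \<rho>] by simp
    with assms(3) show False by (simp add: Arg_pos_iff)
  qed
  ultimately show ?thesis
    using assms(1) \<rho> w by (intro powr_branch_eq_powr) auto
qed

text \<open>\<open>f\<close> is any function equal to the branch on the disc, so this serves the
  branch itself, the principal power where both agree, and \<open>T / \<rho>\<close> with centre
  1.\<close>

lemma has_fun_calc_powr_branch:
  fixes T :: "'a::complex_banach \<Rightarrow>\<^sub>L 'a"
  assumes T: "complex_linear T" and K: "spectrum T \<subseteq> ball \<rho> (cmod \<rho>)" and \<rho>: "\<rho> \<noteq> 0"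
    and f: "\<And>w. w \<in> ball \<rho> (cmod \<rho>) \<Longrightarrow> f w = powr_branch \<rho> \<alpha> w"
  shows "\<exists>S. has_fun_calc f T S \<and>
    (\<lambda>n. (\<rho> powr \<alpha> * (\<alpha> gchoose n) / \<rho> ^ n) *\<^sub>C op_power (T - \<rho> *\<^sub>C id_blinfun) n) sums S"
proof (rule has_fun_calc_power_series[OF T K])
  have "powr_branch \<rho> \<alpha> holomorphic_on ball \<rho> (cmod \<rho>)"
    by (rule holomorphic_on_subset[OF powr_branch_holomorphic[OF \<rho>] ball_norm_subset_half_plane])
  then show "f holomorphic_on ball \<rho> (cmod \<rho>)"
    by (rule holomorphic_transform) (simp only: f)
qed (use \<rho> powr_branch_sums f in auto)

theorem has_fun_calc_principal_powr:
  fixes T :: "'a::complex_banach \<Rightarrow>\<^sub>L 'a"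
  assumes T: "complex_linear T" and K: "spectrum T \<subseteq> ball \<rho> (cmod \<rho>)" and \<rho>: "\<rho> \<noteq> 0"
    and Arg: "\<alpha> \<in> \<int> \<or> (\<forall>w\<in>spectrum T. - pi < Arg \<rho> + Arg (w / \<rho>) \<and> Arg \<rho> + Arg (w / \<rho>) < pi)"
  shows "\<exists>S. has_fun_calc (\<lambda>w. w powr \<alpha>) T S \<and>
    (\<lambda>n. (\<rho> powr \<alpha> * (\<alpha> gchoose n) / \<rho> ^ n) *\<^sub>C op_power (T - \<rho> *\<^sub>C id_blinfun) n) sums S"
proof -
  have Arg_ball: "\<bar>Arg (w / \<rho>)\<bar> < pi / 2" if "w \<in> ball \<rho> (cmod \<rho>)" for w
    using that ball_norm_subset_half_plane[of \<rho>] by (intro abs_Arg_divide_less[OF \<rho>]) blast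
  have Arg_K: "Arg w = Arg \<rho> + Arg (w / \<rho>)"
    if "w \<in> spectrum T" "- pi < Arg \<rho> + Arg (w / \<rho>)" "Arg \<rho> + Arg (w / \<rho>) < pi" for w
  proof -
    have "w \<noteq> 0" using that(1) K by auto
    then show ?thesis
      using Arg_times'[of \<rho> "w / \<rho>"] \<rho> that(2,3) by simp
  qed
  consider "\<alpha> \<in> \<int>" | "\<bar>Arg \<rho>\<bar> \<le> pi / 2" | "\<alpha> \<notin> \<int>" "pi / 2 < Arg \<rho>" | "\<alpha> \<notin> \<int>" "Arg \<rho> < - pi / 2"
    by linarith
  then show ?thesis
  proof cases
    case 1
    then show ?thesis
      using \<rho> by (intro has_fun_calc_powr_branch[OF T K \<rho>] powr_branch_Ints[symmetric]) auto
  next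
    \<comment> \<open>Both summands are at most pi/2 in modulus and the second strictly less, so the
      disc does not meet the cut.\<close>
    case 2
    then show ?thesis
      using \<rho> by (intro has_fun_calc_powr_branch[OF T K \<rho>] powr_branch_eq_powr[symmetric]; use Arg_ball in force)
  next
    case 3
    \<comment> \<open>Here \<open>Arg w\<close> is the sum of arguments, which exceeds pi/2 - pi/2
      and is below pi. So \<open>d = \<i>\<close> works, the half-plane being
      \<open>Im w > 0\<close>; the next case is its reflection.\<close>
    have K_im: "Im w > 0" if w: "w \<in> spectrum T" for w
    proof -
      have "0 < Arg w" "Arg w < pi"
        using Arg 3 w Arg_K[OF w] Arg_ball[of w] K by force+
      then show ?thesis using Arg_lt_pi by blast
    qed
    have \<rho>_im: "0 \<le> Im \<rho>"
      using 3 Arg_less_0[of \<rho>] pi_gt_zero by linarith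
    show ?thesis
      by (rule has_fun_calc_two_half_planes[where d = \<i>, OF T K powr_branch_holomorphic[OF \<rho>]
            _ _ _ _ \<rho> _ powr_branch_sums])
         (use K_im \<rho>_im 3 \<rho> in \<open>auto intro!: holomorphic_intros powr_branch_eq_powr_upper simp: complex_nonpos_Reals_iff add_pos_nonneg\<close>)
  next
    case 4
    have K_im: "Im w < 0" if w: "w \<in> spectrum T" for w
    proof -
      have "Arg w < 0"
        using Arg 4 w Arg_K[OF w] Arg_ball[of w] K by force
      then show ?thesis by (simp add: Arg_neg_iff)
    qed
    have \<rho>_im: "Im \<rho> < cmod \<rho>"
      using 4 Arg_neg_iff[of \<rho>] pi_gt_zero norm_ge_zero[of \<rho>] by linarith
    show ?thesis
      by (rule has_fun_calc_two_half_planes[where d = "- \<i>", OF T K powr_branch_holomorphic[OF \<rho>]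
            _ _ _ _ \<rho> _ powr_branch_sums])
         (use K_im \<rho>_im 4 \<rho> in \<open>auto intro!: holomorphic_intros powr_branch_eq_powr_lower simp: complex_nonpos_Reals_iff\<close>)
  qed
qed

section \<open>The Pochhammer--Newton series\<close>

text \<open>\<open>\<rho> powr (\<alpha> - of_nat k)\<close> distributes as
  \<open>\<rho> powr \<alpha>\<close> outside and \<open>1 / \<rho> ^ k\<close> on the powers of
  \<open>T\<close>. The sign in \<open>pochhammer_newton n \<alpha>\<close> cancels the one of the
  inner sum.\<close>

lemma pochhammer_newton_term:
  fixes T :: "'a::complex_banach \<Rightarrow>\<^sub>L 'a"
  assumes T: "complex_linear T" and \<rho>: "\<rho> \<noteq> 0"
  shows "pochhammer_newton n \<alpha> *\<^sub>C
      (\<Sum>k\<le>n. (pochhammer_newton k (of_nat n) * \<rho> powr (\<alpha> - of_nat k)) *\<^sub>C op_power T k)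
    = (\<rho> powr \<alpha> * (\<alpha> gchoose n) / \<rho> ^ n) *\<^sub>C op_power (T - \<rho> *\<^sub>C id_blinfun) n"
proof -
  let ?A = "(1 / \<rho>) *\<^sub>C T"
  have A: "complex_linear ?A" and D: "complex_linear (T - \<rho> *\<^sub>C id_blinfun)"
    using T by (auto intro!: complex_linear_intros)
  have eq: "?A - id_blinfun = (1 / \<rho>) *\<^sub>C (T - \<rho> *\<^sub>C id_blinfun)"
    using \<rho> by (simp add: scaleC.diff_right scaleC_scaleC)
  have "\<rho> powr (\<alpha> - of_nat k) *\<^sub>C op_power T k = \<rho> powr \<alpha> *\<^sub>C op_power ?A k" for k
    using \<rho> by (simp add: op_power_scaleC[OF T] scaleC_scaleC powr_diff powr_nat' power_divide)
  then have "(\<Sum>k\<le>n. (pochhammer_newton k (of_nat n) * \<rho> powr (\<alpha> - of_nat k)) *\<^sub>C op_power T k)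
      = \<rho> powr \<alpha> *\<^sub>C (\<Sum>k\<le>n. pochhammer_newton k (of_nat n) *\<^sub>C op_power ?A k)"
    unfolding scaleC.sum_right by (intro sum.cong) (auto simp: scaleC_scaleC[symmetric], simp add: scaleC_scaleC mult.commute)
  then show ?thesis
    unfolding sum_pochhammer_newton_op_power[OF A] eq op_power_scaleC[OF D]
    by (simp add: scaleC_scaleC pochhammer_newton_def power_divide minus_one_power_iff mult.commute)
qed

theorem theorem1:
  fixes T :: "'a::complex_banach \<Rightarrow>\<^sub>L 'a" and z :: complex
  assumes "complex_linear T"
    and "spectrum T \<subset> ball z (cmod z)"
  shows "(\<exists>\<rho>. \<rho> \<noteq> 0 \<and> (\<lambda>w. w / \<rho>) ` spectrum T = spectrum ((1 / \<rho>) *\<^sub>C T) \<and>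
              spectrum ((1 / \<rho>) *\<^sub>C T) \<subseteq> ball 1 1) \<and>
    (\<forall>\<rho>. \<rho> \<noteq> 0 \<and> (\<lambda>w. w / \<rho>) ` spectrum T = spectrum ((1 / \<rho>) *\<^sub>C T) \<and>
              spectrum ((1 / \<rho>) *\<^sub>C T) \<subseteq> ball 1 1 \<longrightarrow>
      (\<forall>\<alpha>.
        (\<exists>S. has_fun_calc (\<lambda>w. w powr \<alpha>) ((1 / \<rho>) *\<^sub>C T) S \<and>
          (\<lambda>n. pochhammer_newton n \<alpha> *\<^sub>C
             (\<Sum>k\<le>n. pochhammer_newton k (of_nat n) *\<^sub>C op_power ((1 / \<rho>) *\<^sub>C T) k)) sums S) \<and>
        (\<exists>S. has_fun_calc (powr_branch \<rho> \<alpha>) T S \<and>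
          (\<lambda>n. pochhammer_newton n \<alpha> *\<^sub>C
             (\<Sum>k\<le>n. (pochhammer_newton k (of_nat n) * \<rho> powr (\<alpha> - of_nat k)) *\<^sub>C op_power T k)) sums S) \<and>
        (\<alpha> \<in> \<int> \<or> (\<forall>w\<in>spectrum T. - pi < Arg \<rho> + Arg (w / \<rho>) \<and> Arg \<rho> + Arg (w / \<rho>) < pi) \<longrightarrow>
          (\<exists>S. has_fun_calc (\<lambda>w. w powr \<alpha>) T S \<and>
            (\<lambda>n. pochhammer_newton n \<alpha> *\<^sub>C
               (\<Sum>k\<le>n. (pochhammer_newton k (of_nat n) * \<rho> powr (\<alpha> - of_nat k)) *\<^sub>C op_power T k)) sums S))))"
proof -
  note T = assms(1)
  have scale: "w / \<rho> \<in> ball 1 1 \<longleftrightarrow> w \<in> ball \<rho> (cmod \<rho>)" if "\<rho> \<noteq> 0" for w \<rho> :: complex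
  proof -
    have "cmod (1 - w / \<rho>) = cmod (\<rho> - w) / cmod \<rho>"
      using that by (simp add: norm_divide[symmetric] diff_divide_distrib)
    then show ?thesis
      using that by (simp add: dist_norm pos_divide_less_eq)
  qed
  show ?thesis
  proof (intro conjI allI impI exI[of _ z])
    \<comment> \<open>The witness is the given centre \<open>z\<close>. For \<open>z = 0\<close> the
      disc would be empty and have no proper subset.\<close>
    show z: "z \<noteq> 0"
      using assms(2) by auto
    show im: "(\<lambda>w. w / z) ` spectrum T = spectrum ((1 / z) *\<^sub>C T)"
      by (rule spectrum_scaleC[OF T z])
    show "spectrum ((1 / z) *\<^sub>C T) \<subseteq> ball 1 1"
      unfolding im[symmetric] using assms(2) scale[OF z] by (intro image_subsetI) blast
  next
    fix \<rho> \<alpha>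
    assume "\<rho> \<noteq> 0 \<and> (\<lambda>w. w / \<rho>) ` spectrum T = spectrum ((1 / \<rho>) *\<^sub>C T)
      \<and> spectrum ((1 / \<rho>) *\<^sub>C T) \<subseteq> ball 1 1"
    then have \<rho>: "\<rho> \<noteq> 0" and im: "(\<lambda>w. w / \<rho>) ` spectrum T = spectrum ((1 / \<rho>) *\<^sub>C T)"
      and sub: "spectrum ((1 / \<rho>) *\<^sub>C T) \<subseteq> ball 1 1"
      by auto
    have K: "spectrum T \<subseteq> ball \<rho> (cmod \<rho>)"
      using im sub scale[OF \<rho>] by blast
    let ?A = "(1 / \<rho>) *\<^sub>C T"
    have A: "complex_linear ?A"
      using T by (rule complex_linear_scaleC)
    \<comment> \<open>The centre is 1: \<open>powr_branch 1 \<alpha>\<close> is the principal power,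
      holomorphic on \<open>ball 1 1\<close>.\<close>
    have "\<exists>S. has_fun_calc (\<lambda>w. w powr \<alpha>) ?A S \<and>
        (\<lambda>n. (1 powr \<alpha> * (\<alpha> gchoose n) / 1 ^ n) *\<^sub>C op_power (?A - 1 *\<^sub>C id_blinfun) n) sums S"
      by (rule has_fun_calc_powr_branch[OF A]) (use sub in \<open>auto simp: powr_branch_def\<close>)
    then show "\<exists>S. has_fun_calc (\<lambda>w. w powr \<alpha>) ?A S \<and>
        (\<lambda>n. pochhammer_newton n \<alpha> *\<^sub>C
           (\<Sum>k\<le>n. pochhammer_newton k (of_nat n) *\<^sub>C op_power ?A k)) sums S"
      using pochhammer_newton_term[OF A, of 1] by simp
    show "\<exists>S. has_fun_calc (powr_branch \<rho> \<alpha>) T S \<and>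
        (\<lambda>n. pochhammer_newton n \<alpha> *\<^sub>C
           (\<Sum>k\<le>n. (pochhammer_newton k (of_nat n) * \<rho> powr (\<alpha> - of_nat k)) *\<^sub>C op_power T k)) sums S"
      unfolding pochhammer_newton_term[OF T \<rho>] by (rule has_fun_calc_powr_branch[OF T K \<rho> refl])
    assume "\<alpha> \<in> \<int> \<or> (\<forall>w\<in>spectrum T. - pi < Arg \<rho> + Arg (w / \<rho>) \<and> Arg \<rho> + Arg (w / \<rho>) < pi)"
    then show "\<exists>S. has_fun_calc (\<lambda>w. w powr \<alpha>) T S \<and>
        (\<lambda>n. pochhammer_newton n \<alpha> *\<^sub>C
           (\<Sum>k\<le>n. (pochhammer_newton k (of_nat n) * \<rho> powr (\<alpha> - of_nat k)) *\<^sub>C op_power T k)) sums S"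
      unfolding pochhammer_newton_term[OF T \<rho>] by (rule has_fun_calc_principal_powr[OF T K \<rho>])
  qed
qed

end
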